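(* Let $a<b$ be real numbers, $0<\alpha<1$, $p\ge 1$, $q\ge 1$, and $\frac1p+\frac1q\le 1+\alpha$ (with $p\ne 1$ and $q\neq 1$ in the case $\frac1p+\frac1q=1+\alpha$). Then: (1) If $\varphi\in L_p(a,b)$ and $\psi\in L_q(a,b)$, then $$\int_a^b \varphi(x)\,({}^{AB}{}_{a}I^\alpha\psi)(x)\,dx=\frac{1-\alpha}{B(\alpha)}\int_a^b\psi(x)\varphi(x)\,dx+\frac{\alpha}{B(\alpha)}\int_a^b (I_b^\alpha\varphi)(x)\,\psi(x)\,dx=\int_a^b\psi(x)\,({}^{AB}I_b^\alpha\varphi)(x)\,dx,$$ and similarly $$\int_a^b \varphi(x)\,({}^{AB}I_b^\alpha\psi)(x)\,dx=\frac{1-\alpha}{B(\alpha)}\int_a^b\psi(x)\varphi(x)\,dx+\frac{\alpha}{B(\alpha)}\int_a^b ({}_{a}I^\alpha\varphi)(x)\,\psi(x)\,dx=\int_a^b\psi(x)\,({}^{AB}{}_{a}I^\alpha\varphi)(x)\,dx.$$ (2) If $f\in {}^{AB}I_b^\alpha(L_p)$ and $g\in {}^{AB}{}_{a}I^\alpha(L_q)$, then $$\int_a^b f(x)\,({}^{ABR}{}_{a}D^\alpha g)(x)\,dx=\int_a^b({}^{ABR}D_b^\alpha f)(x)\,g(x)\,dx.$$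
   Context: $B(\alpha)>0$ is a normalization constant depending on $\alpha$. $E_\alpha(z)=\sum_{k\ge0}\frac{z^k}{\Gamma(\alpha k+1)}$ is the Mittag-Leffler function. The left and right Riemann-Liouville fractional integrals are $$({}_{a}I^\alpha f)(t)=\frac1{\Gamma(\alpha)}\int_a^t(t-s)^{\alpha-1}f(s)\,ds,\qquad (I_b^\alpha f)(t)=\frac1{\Gamma(\alpha)}\int_t^b(s-t)^{\alpha-1}f(s)\,ds.$$ The left and right fractional integrals associated with the Mittag-Leffler kernel are $$({}^{AB}{}_{a}I^\alpha f)(t)=\frac{1-\alpha}{B(\alpha)}f(t)+\frac{\alpha}{B(\alpha)}({}_{a}I^\alpha f)(t),\qquad ({}^{AB}I_b^\alpha f)(t)=\frac{1-\alpha}{B(\alpha)}f(t)+\frac{\alpha}{B(\alpha)}(I_b^\alpha f)(t).$$ The left and right Riemann-Liouville-type fractional derivatives with Mittag-Leffler kernel are $$({}^{ABR}{}_{a}D^\alpha f)(t)=\frac{B(\alpha)}{1-\alpha}\frac{d}{dt}\int_a^t f(x)\,E_\alpha\!\left[-\alpha\frac{(t-x)^\alpha}{1-\alpha}\right]dx,$$ $$({}^{ABR}D_b^\alpha f)(t)=-\frac{B(\alpha)}{1-\alpha}\frac{d}{dt}\int_t^b f(x)\,E_\alpha\!\left[-\alpha\frac{(x-t)^\alpha}{1-\alpha}\right]dx.$$ Function spaces: ${}^{AB}{}_{a}I^\alpha(L_p)=\{f: f={}^{AB}{}_{a}I^\alpha\varphi,\ \varphi\in L_p(a,b)\}$ and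 ${}^{AB}I_b^\alpha(L_p)=\{f: f={}^{AB}I_b^\alpha\phi,\ \phi\in L_p(a,b)\}$.
   Formalization: In (1) the middle expression is equated with the outer integrals only when the product ψφ is integrable on (a,b), which can fail for 1/p+1/q>1 and is exactly when the outer integrals exist; the outer equality and (2) are unconditional, undefined integrals counting as 0. *)

theory Defs
  imports "HOL-Analysis.Analysis"
begin

text \<open>
  All integrals are Lebesgue integrals with respect to the completed measure
  \<^const>\<open>lebesgue\<close>, so that functions may be changed on null sets without affecting
  measurability. Elements of $L_p(a,b)$ are represented by functions on the whole real line of
  which only the values on the open interval \<open>{a<..<b}\<close> matter.
\<close>

definition Lp_space :: "real \<Rightarrow> real \<Rightarrow> real \<Rightarrow> (real \<Rightarrow> real) set" where
  "Lp_space p a b =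
     {f. set_borel_measurable lebesgue {a<..<b} f \<and>
         set_integrable lebesgue {a<..<b} (\<lambda>x. \<bar>f x\<bar> powr p)}"

definition mittag_leffler :: "real \<Rightarrow> real \<Rightarrow> real" where
  "mittag_leffler \<alpha> z = (\<Sum>k. z ^ k / Gamma (\<alpha> * real k + 1))"

definition RL_int_left :: "real \<Rightarrow> real \<Rightarrow> (real \<Rightarrow> real) \<Rightarrow> real \<Rightarrow> real" where
  "RL_int_left \<alpha> a f t =
     1 / Gamma \<alpha> * (LINT s:{a<..<t}|lebesgue. (t - s) powr (\<alpha> - 1) * f s)"

definition RL_int_right :: "real \<Rightarrow> real \<Rightarrow> (real \<Rightarrow> real) \<Rightarrow> real \<Rightarrow> real" where
  "RL_int_right \<alpha> b f t =
     1 / Gamma \<alpha> * (LINT s:{t<..<b}|lebesgue. (s - t) powr (\<alpha> - 1) * f s)"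

text \<open>In what follows, \<open>B\<close> is the normalization function $\alpha \mapsto B(\alpha)$.\<close>

definition AB_int_left ::
    "(real \<Rightarrow> real) \<Rightarrow> real \<Rightarrow> real \<Rightarrow> (real \<Rightarrow> real) \<Rightarrow> real \<Rightarrow> real" where
  "AB_int_left B \<alpha> a f t = (1 - \<alpha>) / B \<alpha> * f t + \<alpha> / B \<alpha> * RL_int_left \<alpha> a f t"

definition AB_int_right ::
    "(real \<Rightarrow> real) \<Rightarrow> real \<Rightarrow> real \<Rightarrow> (real \<Rightarrow> real) \<Rightarrow> real \<Rightarrow> real" where
  "AB_int_right B \<alpha> b f t = (1 - \<alpha>) / B \<alpha> * f t + \<alpha> / B \<alpha> * RL_int_right \<alpha> b f t"

definition ABR_deriv_left ::
    "(real \<Rightarrow> real) \<Rightarrow> real \<Rightarrow> real \<Rightarrow> (real \<Rightarrow> real) \<Rightarrow> real \<Rightarrow> real" where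
  "ABR_deriv_left B \<alpha> a f t =
     B \<alpha> / (1 - \<alpha>) *
     deriv (\<lambda>u. LINT x:{a<..<u}|lebesgue.
              f x * mittag_leffler \<alpha> (- \<alpha> * ((u - x) powr \<alpha> / (1 - \<alpha>)))) t"

definition ABR_deriv_right ::
    "(real \<Rightarrow> real) \<Rightarrow> real \<Rightarrow> real \<Rightarrow> (real \<Rightarrow> real) \<Rightarrow> real \<Rightarrow> real" where
  "ABR_deriv_right B \<alpha> b f t =
     - (B \<alpha> / (1 - \<alpha>)) *
     deriv (\<lambda>u. LINT x:{u<..<b}|lebesgue.
              f x * mittag_leffler \<alpha> (- \<alpha> * ((x - u) powr \<alpha> / (1 - \<alpha>)))) t"

text \<open>
  The images of $L_p(a,b)$ under the two integral operators. Since the elements of $L_p(a,b)$ are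
  functions up to equality almost everywhere, so is the equation \<open>f = AB_int \<phi>\<close>.
\<close>

definition AB_int_left_Lp ::
    "(real \<Rightarrow> real) \<Rightarrow> real \<Rightarrow> real \<Rightarrow> real \<Rightarrow> real \<Rightarrow> (real \<Rightarrow> real) set" where
  "AB_int_left_Lp B \<alpha> p a b =
     {f. \<exists>\<phi>\<in>Lp_space p a b.
           AE x in lebesgue. x \<in> {a<..<b} \<longrightarrow> f x = AB_int_left B \<alpha> a \<phi> x}"

definition AB_int_right_Lp ::
    "(real \<Rightarrow> real) \<Rightarrow> real \<Rightarrow> real \<Rightarrow> real \<Rightarrow> real \<Rightarrow> (real \<Rightarrow> real) set" where
  "AB_int_right_Lp B \<alpha> p a b =
     {f. \<exists>\<phi>\<in>Lp_space p a b.
           AE x in lebesgue. x \<in> {a<..<b} \<longrightarrow> f x = AB_int_right B \<alpha> b \<phi> x}"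

end

theory Submission
  imports Defs
begin

text \<open>
  Everything rests on the finiteness of
  $\int\int |\varphi(x)|\,|\psi(y)|\,|x-y|^{\alpha-1}\,dx\,dy$; part (1) is then Fubini's theorem.
  On the bounded interval, exponents greater than 1 may be lowered until $1/p+1/q=1+\alpha$, and this
  critical case is proved by splitting the plane according to whether $|\psi(y)|^q\le|\varphi(x)|^p$:
  the potential of $\psi$ cut off at height $T$ is $O(T^{1-\alpha q})$, and for $T=|\varphi(x)|^{p/q}$
  this is $O(|\varphi(x)|^{p-1})$.

  For part (2), $K(u)=E_\alpha(-\lambda u^\alpha)$ with $\lambda=\alpha/(1-\alpha)$ satisfies
  $K+\lambda I^\alpha K=1$ (Beta integrals, term by term). Convolving
  $({}^{AB}I^\alpha\psi)$ with $K$ and moving $I^\alpha$ onto $K$ by Fubini therefore gives a multiple of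
  $\int\psi$, so by Lebesgue's differentiation theorem the ABR derivative inverts the AB integral
  almost everywhere, and part (2) reduces to part (1).
\<close>

subsection \<open>Weakly singular potentials\<close>

text \<open>For 1 < 1/p + 1/q \<le> 1 + \<alpha> the product \<psi>\<phi> need not be integrable;
  the double integral controls only the terms with a fractional integral. Hence the middle
  expression of part (1) is asserted only for integrable \<psi>\<phi>, whereas the outer equality
  holds always: both AB integrands are integrable exactly when \<psi>\<phi> is, and otherwise both
  integrals are 0 by convention. Part (2) inherits this. An exponent equal to 1 is treated apart. It
  cannot be lowered, and the critical inequality fails with such an exponent; off the critical line
  the other exponent exceeds 1/\<alpha>, which makes the potential bounded. Only finiteness of the
  double integral is wanted, not a norm estimate, so constants are wasted freely. Fubini needs Borel
  functions, while the data are given up to null sets of the completed measure. Completeness allows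
  passing to Borel representatives and back with no measurability hypothesis on the functions being
  replaced.\<close>

text \<open>The larger of the two powers dominates the product by itself: if
  \<open>v powr (q / (q - 1))\<close> is at most \<open>u powr q\<close>, then \<open>v\<close> is
  at most \<open>u powr (q - 1)\<close>; the other case is symmetric. The sharp constants of Young's
  inequality are given away.\<close>

lemma weak_Young:
  fixes u v q :: real
  assumes "u \<ge> 0" "v \<ge> 0" "q > 1"
  shows "u * v \<le> u powr q + v powr (q / (q - 1))"
proof (cases "v powr (q / (q - 1)) \<le> u powr q")
  case True
  then have "(v powr (q / (q - 1))) powr ((q - 1) / q) \<le> (u powr q) powr ((q - 1) / q)"
    using assms by (intro powr_mono2) auto
  then have "v \<le> u powr (q - 1)"
    using assms by (simp add: powr_powr)
  then have "u * v \<le> u * u powr (q - 1)"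
    using assms by (intro mult_left_mono) auto
  also have "\<dots> = u powr q"
    using assms by (simp add: powr_mult_base)
  finally show ?thesis
    by (smt (verit) powr_ge_zero)
next
  case False
  define q' where "q' = q / (q - 1)"
  have q': "q' - 1 = q' / q"
    using assms unfolding q'_def by (simp add: field_simps)
  from False have "(u powr q) powr (1 / q) \<le> (v powr q') powr (1 / q)"
    using assms unfolding q'_def by (intro powr_mono2) auto
  then have "u \<le> v powr (q' - 1)"
    using assms by (simp add: powr_powr q')
  then have "u * v \<le> v powr (q' - 1) * v"
    using assms by (intro mult_right_mono) auto
  also have "\<dots> = v powr q'"
    using assms by (simp add: powr_mult_base mult.commute)
  finally show ?thesis
    unfolding q'_def by (smt (verit) powr_ge_zero)
qed

text \<open>The half-lines on either side of \<open>x\<close> contribute the same amount. Both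
  contain the point \<open>y = x\<close>, so the pointwise comparison is an inequality.\<close>

lemma nn_integral_abs_diff_le:
  fixes h :: "real \<Rightarrow> ennreal"
  assumes [measurable]: "h \<in> borel_measurable borel"
  shows "(\<integral>\<^sup>+y. h \<bar>x - y\<bar> \<partial>lborel) \<le> 2 * (\<integral>\<^sup>+t. h t * indicator {0..} t \<partial>lborel)"
proof -
  let ?h = "\<lambda>t. h t * indicator {0..} t"
  have "(\<integral>\<^sup>+y. h \<bar>x - y\<bar> \<partial>lborel) \<le> (\<integral>\<^sup>+y. ?h (x - y) + ?h (y - x) \<partial>lborel)"
    by (intro nn_integral_mono) (auto simp: indicator_def abs_if)
  also have "\<dots> = (\<integral>\<^sup>+y. ?h (x - y) \<partial>lborel) + (\<integral>\<^sup>+y. ?h (y - x) \<partial>lborel)"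
    by (intro nn_integral_add) auto
  also have "(\<integral>\<^sup>+y. ?h (x - y) \<partial>lborel) = (\<integral>\<^sup>+t. ?h t \<partial>lborel)"
    by (subst nn_integral_real_affine[where c = "-1" and t = x]) (auto simp: one_ennreal_def[symmetric])
  also have "(\<integral>\<^sup>+y. ?h (y - x) \<partial>lborel) = (\<integral>\<^sup>+t. ?h t \<partial>lborel)"
    by (subst nn_integral_real_affine[where c = 1 and t = x]) (auto simp: one_ennreal_def[symmetric])
  finally show ?thesis
    by (simp add: mult_2)
qed

lemma nn_integral_abs_powr_near:
  fixes r c :: real
  assumes "r > -1" "c \<ge> 0"
  shows "(\<integral>\<^sup>+y. ennreal (\<bar>x - y\<bar> powr r * indicator {..c} \<bar>x - y\<bar>) \<partial>lborel)
         \<le> ennreal (2 * (c powr (r + 1) / (r + 1)))"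
proof -
  have "(\<integral>\<^sup>+t. ennreal (t powr r * indicator {..c} t) * indicator {0..} t \<partial>lborel)
        = (\<integral>\<^sup>+t. ennreal (t powr r) * indicator {0..c} t \<partial>lborel)"
    by (intro nn_integral_cong) (auto simp: indicator_def)
  also have "\<dots> = ennreal (c powr (r + 1) / (r + 1))"
    using nn_integral_has_integral_lebesgue[OF _ has_integral_powr_from_0[OF assms]]
    by (simp add: ennreal_mult' ennreal_indicator mult.commute)
  finally have "2 * (\<integral>\<^sup>+t. ennreal (t powr r * indicator {..c} t) * indicator {0..} t \<partial>lborel)
        = ennreal (2 * (c powr (r + 1) / (r + 1)))"
    by (metis ennreal_mult'' ennreal_numeral assms(1) divide_nonneg_pos powr_ge_zero real_0_less_add_iff add.commute)
  then show ?thesis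
    using nn_integral_abs_diff_le[of "\<lambda>t. ennreal (t powr r * indicator {..c} t)" x] by simp
qed

lemma nn_integral_abs_powr_far:
  fixes r c :: real
  assumes "r < -1" "c > 0"
  shows "(\<integral>\<^sup>+y. ennreal (\<bar>x - y\<bar> powr r * indicator {c..} \<bar>x - y\<bar>) \<partial>lborel)
         \<le> ennreal (2 * (- (c powr (r + 1)) / (r + 1)))"
proof -
  have "(\<integral>\<^sup>+t. ennreal (t powr r * indicator {c..} t) * indicator {0..} t \<partial>lborel)
        = (\<integral>\<^sup>+t. ennreal (t powr r) * indicator {c..} t \<partial>lborel)"
    using assms by (intro nn_integral_cong) (auto simp: indicator_def)
  also have "\<dots> = ennreal (- (c powr (r + 1)) / (r + 1))"
    using nn_integral_has_integral_lebesgue[OF _ has_integral_powr_to_inf[OF assms]]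
    by (simp add: ennreal_mult' ennreal_indicator mult.commute)
  finally have "2 * (\<integral>\<^sup>+t. ennreal (t powr r * indicator {c..} t) * indicator {0..} t \<partial>lborel)
        = 2 * ennreal (- (c powr (r + 1)) / (r + 1))" by simp
  also have "\<dots> = ennreal (2 * (- (c powr (r + 1)) / (r + 1)))"
    using assms by (subst ennreal_mult) (auto simp: divide_nonneg_neg divide_nonpos_neg)
  finally show ?thesis
    using nn_integral_abs_diff_le[of "\<lambda>t. ennreal (t powr r * indicator {c..} t)" x] by simp
qed

text \<open>\<open>C\<close> must serve all \<open>x\<close> and \<open>T\<close> at once, because
  \<open>T\<close> is later chosen as a function of \<open>x\<close>. The condition
  \<open>\<alpha> * q < 1\<close> is equivalent to \<open>r < -1\<close>, where \<open>r\<close> is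
  the exponent of the kernel raised to the conjugate power \<open>q'\<close>; this power is then
  integrable away from the singularity.\<close>

lemma truncated_potential_bound:
  fixes G :: "real \<Rightarrow> real" and \<alpha> q :: real
  assumes [measurable]: "G \<in> borel_measurable borel" and G: "\<And>y. G y \<ge> 0"
    and fin: "(\<integral>\<^sup>+y. ennreal (G y powr q) \<partial>lborel) < \<infinity>"
    and \<alpha>: "0 < \<alpha>" "\<alpha> < 1" and q: "q > 1" "\<alpha> * q < 1"
  shows "\<exists>C\<ge>0. \<forall>T>0. \<forall>x.
    (\<integral>\<^sup>+y. ennreal (\<bar>x - y\<bar> powr (\<alpha> - 1) * G y * (if G y \<le> T then 1 else 0)) \<partial>lborel)
      \<le> ennreal (C * T powr (1 - \<alpha> * q))"
proof -
  define q' where "q' = q / (q - 1)"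
  define r where "r = (\<alpha> - 1) * q'"
  have q': "q' > 1" using q unfolding q'_def by simp
  have r: "r < -1"
    using q \<alpha> unfolding r_def q'_def by (simp add: field_simps)
  obtain N where N: "(\<integral>\<^sup>+y. ennreal (G y powr q) \<partial>lborel) = ennreal N" "N \<ge> 0"
    using fin by (cases "(\<integral>\<^sup>+y. ennreal (G y powr q) \<partial>lborel)") auto
  \<comment> \<open>The summands are the coefficients of \<open>T powr e\<close> coming from the
    region near \<open>x\<close>, from the \<open>G\<close> half of Young's inequality and from its
    kernel half.\<close>
  define C where "C = 2 / \<alpha> + N + 2 / (- (r + 1))"
  have C: "C \<ge> 0"
    using \<alpha> N r unfolding C_def by (intro add_nonneg_nonneg divide_nonneg_pos) auto
  have "(\<integral>\<^sup>+y. ennreal (\<bar>x - y\<bar> powr (\<alpha> - 1) * G y * (if G y \<le> T then 1 else 0)) \<partial>lborel)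
      \<le> ennreal (C * T powr (1 - \<alpha> * q))" if T: "T > 0" for T x
  proof -
    define e where "e = 1 - \<alpha> * q"
    define \<delta> where "\<delta> = T powr (- q)"
    define l where "l = T powr (e / q)"
    \<comment> \<open>For \<open>\<bar>x - y\<bar> \<le> \<delta>\<close> bound \<open>G y\<close> by \<open>T\<close>; elsewhere use Young's inequality. The choice of \<open>\<delta>\<close> and
      of the weight \<open>l\<close> makes all three terms multiples of \<open>T powr e\<close>.\<close>
    have \<delta>: "\<delta> > 0" and l: "l > 0"
      using T unfolding \<delta>_def l_def by auto
    let ?n = "\<lambda>y. \<bar>x - y\<bar> powr (\<alpha> - 1) * indicator {..\<delta>} \<bar>x - y\<bar>"
    let ?f = "\<lambda>y. \<bar>x - y\<bar> powr r * indicator {\<delta>..} \<bar>x - y\<bar>"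
    have pw: "\<bar>x - y\<bar> powr (\<alpha> - 1) * G y * (if G y \<le> T then 1 else 0)
        \<le> T * ?n y + l powr q * G y powr q + (1 / l) powr q' * ?f y" (is "?L \<le> _") for y
    proof (cases "\<bar>x - y\<bar> \<le> \<delta>")
      case True
      have "?L \<le> T * ?n y"
        using True T G[of y]
        by (auto simp: indicator_def mult.commute[of T] intro!: mult_left_mono)
      moreover have "0 \<le> l powr q * G y powr q + (1 / l) powr q' * ?f y" by simp
      ultimately show ?thesis by linarith
    next
      case False
      have "?L \<le> (l * G y) * (\<bar>x - y\<bar> powr (\<alpha> - 1) / l)"
        using l G[of y] by (auto simp: indicator_def)
      also have "\<dots> \<le> (l * G y) powr q + (\<bar>x - y\<bar> powr (\<alpha> - 1) / l) powr q'"
        unfolding q'_def using l G[of y] q by (intro weak_Young) auto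
      also have "(l * G y) powr q = l powr q * G y powr q"
        using l G[of y] by (simp add: powr_mult)
      also have "(\<bar>x - y\<bar> powr (\<alpha> - 1) / l) powr q' = (1 / l) powr q' * ?f y"
        using l False by (simp add: powr_divide powr_powr r_def)
      finally have "?L \<le> l powr q * G y powr q + (1 / l) powr q' * ?f y" .
      moreover have "0 \<le> T * ?n y" using T by simp
      ultimately show ?thesis by linarith
    qed
    have "(\<integral>\<^sup>+y. ennreal (\<bar>x - y\<bar> powr (\<alpha> - 1) * G y * (if G y \<le> T then 1 else 0)) \<partial>lborel)
       \<le> (\<integral>\<^sup>+y. ennreal T * ennreal (?n y) + ennreal (l powr q) * ennreal (G y powr q)
            + ennreal ((1 / l) powr q') * ennreal (?f y) \<partial>lborel)"
      using pw T G by (intro nn_integral_mono) (simp flip: ennreal_mult ennreal_plus)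
    also have "\<dots> = ennreal T * (\<integral>\<^sup>+y. ennreal (?n y) \<partial>lborel)
         + ennreal (l powr q) * (\<integral>\<^sup>+y. ennreal (G y powr q) \<partial>lborel)
         + ennreal ((1 / l) powr q') * (\<integral>\<^sup>+y. ennreal (?f y) \<partial>lborel)"
      by (simp add: nn_integral_add nn_integral_cmult)
    also have "\<dots> \<le> ennreal T * ennreal (2 * (\<delta> powr ((\<alpha> - 1) + 1) / ((\<alpha> - 1) + 1)))
         + ennreal (l powr q) * ennreal N
         + ennreal ((1 / l) powr q') * ennreal (2 * (- (\<delta> powr (r + 1)) / (r + 1)))"
      using \<alpha> r \<delta> unfolding N(1)
      by (intro add_mono mult_left_mono nn_integral_abs_powr_near nn_integral_abs_powr_far) auto
    also have "\<dots> = ennreal (T * (2 * (\<delta> powr \<alpha> / \<alpha>)) + l powr q * N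
         + (1 / l) powr q' * (2 * (- (\<delta> powr (r + 1)) / (r + 1))))"
    proof -
      have sum3: "ennreal u1 * ennreal v1 + ennreal u2 * ennreal v2 + ennreal u3 * ennreal v3
          = ennreal (u1 * v1 + u2 * v2 + u3 * v3)"
        if "u1 \<ge> 0" "v1 \<ge> 0" "u2 \<ge> 0" "v2 \<ge> 0" "u3 \<ge> 0" "v3 \<ge> 0" for u1 v1 u2 v2 u3 v3 :: real
        using that by (simp add: ennreal_mult)
      show ?thesis
        by (subst sum3) (use T \<alpha> N(2) r in \<open>auto intro: divide_nonneg_neg\<close>)
    qed
    also have "T * (2 * (\<delta> powr \<alpha> / \<alpha>)) = 2 / \<alpha> * T powr e"
    proof -
      have "T * \<delta> powr \<alpha> = T powr 1 * T powr (- q * \<alpha>)"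
        using T unfolding \<delta>_def by (simp add: powr_powr)
      also have "\<dots> = T powr e"
        unfolding powr_add[symmetric] e_def by (simp add: mult.commute)
      finally show ?thesis by simp
    qed
    also have "l powr q = T powr e"
      using q unfolding l_def by (simp add: powr_powr)
    also have "(1 / l) powr q' * (2 * (- (\<delta> powr (r + 1)) / (r + 1))) = 2 / (- (r + 1)) * T powr e"
    proof -
      have "(1 / l) powr q' = T powr (- (e / q) * q')"
      proof -
        have "1 / l = T powr (- (e / q))"
          unfolding l_def by (simp add: powr_minus_divide)
        then show ?thesis by (simp only: powr_powr)
      qed
      moreover have "\<delta> powr (r + 1) = T powr (- q * (r + 1))"
        unfolding \<delta>_def by (simp add: powr_powr)
      ultimately have "(1 / l) powr q' * \<delta> powr (r + 1) = T powr (- (e / q) * q' + - q * (r + 1))"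
        by (simp only: powr_add)
      \<comment> \<open>Here \<open>r + 1 = - e / (q - 1)\<close>, so the left side is
        \<open>- e / (q - 1) + q * e / (q - 1)\<close>. Writing \<open>q = d + 1\<close> keeps the
        denominator a single variable.\<close>
      also have "- (e / q) * q' + - q * (r + 1) = e"
      proof -
        obtain d where d: "q = d + 1" "d > 0"
          using q by (metis add.commute diff_add_cancel diff_gt_0_iff_gt)
        have "(e / q) * q' = e / d"
          using d q unfolding q'_def by simp
        moreover have "- (e / d) - q * (r + 1) = e"
          using d(2) unfolding r_def q'_def e_def d(1) by (simp add: field_simps)
        ultimately show ?thesis by simp
      qed
      finally show ?thesis
        by (metis (no_types, lifting) minus_divide_left minus_divide_right mult.assoc mult.commute
            times_divide_eq_left)
    qed
    finally show ?thesis
      unfolding C_def e_def by (simp add: algebra_simps)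
  qed
  with C show ?thesis by blast
qed


lemma Hardy_Littlewood_Sobolev_finite:
  fixes F G :: "real \<Rightarrow> real" and \<alpha> p q :: real
  assumes [measurable]: "F \<in> borel_measurable borel" "G \<in> borel_measurable borel"
    and nonneg: "\<And>x. F x \<ge> 0" "\<And>y. G y \<ge> 0"
    and finF: "(\<integral>\<^sup>+x. ennreal (F x powr p) \<partial>lborel) < \<infinity>"
    and finG: "(\<integral>\<^sup>+y. ennreal (G y powr q) \<partial>lborel) < \<infinity>"
    and \<alpha>: "0 < \<alpha>" "\<alpha> < 1" and pq: "p > 1" "q > 1" "1 / p + 1 / q = 1 + \<alpha>"
  shows "(\<integral>\<^sup>+x. \<integral>\<^sup>+y. ennreal (F x * G y * \<bar>x - y\<bar> powr (\<alpha> - 1)) \<partial>lborel \<partial>lborel) < \<infinity>"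
proof -
  \<comment> \<open>Stated for arbitrary functions and exponents, so that it can be applied a second
    time with \<open>(F, p)\<close> and \<open>(G, q)\<close> interchanged.\<close>
  have half: "(\<integral>\<^sup>+x. \<integral>\<^sup>+y. ennreal (F x * (\<bar>x - y\<bar> powr (\<alpha> - 1) * G y * (if G y \<le> F x powr (p / q) then 1 else 0)))
        \<partial>lborel \<partial>lborel) < \<infinity>" (is "?I < _")
    if meas [measurable]: "F \<in> borel_measurable borel" "G \<in> borel_measurable borel"
    and nonneg: "\<And>x. F x \<ge> 0" "\<And>y. G y \<ge> 0"
    and finF: "(\<integral>\<^sup>+x. ennreal (F x powr p) \<partial>lborel) < \<infinity>"
    and finG: "(\<integral>\<^sup>+y. ennreal (G y powr q) \<partial>lborel) < \<infinity>"
    and pq: "p > 1" "q > 1" "1 / p + 1 / q = 1 + \<alpha>"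
  for F G :: "real \<Rightarrow> real" and p q :: real
  proof -
    \<comment> \<open>Criticality gives \<open>1 / q - \<alpha> = 1 - 1 / p\<close>, which is
      positive because \<open>p > 1\<close>: the endpoint exponent 1 is lost here.\<close>
    have \<alpha>q: "\<alpha> * q < 1"
    proof -
      have "\<alpha> < 1 / q" using pq by (smt (verit) divide_less_eq_1_pos)
      then show ?thesis using pq by (simp add: field_simps)
    qed
    obtain C where C: "C \<ge> 0" "\<And>T x. T > 0 \<Longrightarrow>
        (\<integral>\<^sup>+y. ennreal (\<bar>x - y\<bar> powr (\<alpha> - 1) * G y * (if G y \<le> T then 1 else 0)) \<partial>lborel)
        \<le> ennreal (C * T powr (1 - \<alpha> * q))"
      using truncated_potential_bound[OF meas(2) nonneg(2) finG \<alpha> pq(2) \<alpha>q] by blast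
    \<comment> \<open>The exact equality of exponents makes the bound, after multiplication by
      \<open>F x\<close>, a multiple of \<open>F x powr p\<close>, whose integral is finite.\<close>
    have e: "p / q * (1 - \<alpha> * q) = p - 1"
    proof -
      have "1 / q - \<alpha> = 1 - 1 / p" using pq by simp
      then have "p * (1 / q - \<alpha>) = p * (1 - 1 / p)" by simp
      then show ?thesis using pq by (simp add: right_diff_distrib)
    qed
    have "?I = (\<integral>\<^sup>+x. ennreal (F x) * (\<integral>\<^sup>+y. ennreal (\<bar>x - y\<bar> powr (\<alpha> - 1) * G y *
        (if G y \<le> F x powr (p / q) then 1 else 0)) \<partial>lborel) \<partial>lborel)"
      using nonneg by (subst nn_integral_cmult[symmetric]) (auto simp: ennreal_mult)
    also have "\<dots> \<le> (\<integral>\<^sup>+x. ennreal C * ennreal (F x powr p) \<partial>lborel)"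
    proof (intro nn_integral_mono)
      fix x
      show "ennreal (F x) * (\<integral>\<^sup>+y. ennreal (\<bar>x - y\<bar> powr (\<alpha> - 1) * G y *
        (if G y \<le> F x powr (p / q) then 1 else 0)) \<partial>lborel) \<le> ennreal C * ennreal (F x powr p)"
      \<comment> \<open>The truncated bound requires a positive cutoff height, so the zeros of
        \<open>F\<close>, where the left side vanishes, are split off.\<close>
      proof (cases "F x = 0")
        case False
        then have F: "F x > 0" using nonneg(1)[of x] by simp
        have "ennreal (F x) * (\<integral>\<^sup>+y. ennreal (\<bar>x - y\<bar> powr (\<alpha> - 1) * G y *
            (if G y \<le> F x powr (p / q) then 1 else 0)) \<partial>lborel)
          \<le> ennreal (F x) * ennreal (C * (F x powr (p / q)) powr (1 - \<alpha> * q))"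
          using F by (intro mult_left_mono C(2)) auto
        also have "\<dots> = ennreal (C * (F x * F x powr (p - 1)))"
          using F C(1) e by (simp add: powr_powr ennreal_mult[symmetric] mult_ac)
        also have "F x * F x powr (p - 1) = F x powr p"
          using F by (simp add: powr_mult_base)
        finally show ?thesis
          using C(1) by (simp add: ennreal_mult)
      qed simp
    qed
    also have "\<dots> = ennreal C * (\<integral>\<^sup>+x. ennreal (F x powr p) \<partial>lborel)"
      by (simp add: nn_integral_cmult)
    also have "\<dots> < \<infinity>"
      using finF by (simp add: ennreal_mult_less_top)
    finally show ?thesis .
  qed
  let ?A = "\<lambda>x y. F x * (\<bar>x - y\<bar> powr (\<alpha> - 1) * G y * (if G y \<le> F x powr (p / q) then 1 else 0))"
  let ?B = "\<lambda>x y. G y * (\<bar>y - x\<bar> powr (\<alpha> - 1) * F x * (if F x \<le> G y powr (q / p) then 1 else 0))"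
  have pw: "F x * G y * \<bar>x - y\<bar> powr (\<alpha> - 1) \<le> ?A x y + ?B x y" for x y
  proof (cases "G y \<le> F x powr (p / q)")
    case True
    then show ?thesis using nonneg[of x] nonneg[of y] by (simp add: mult_ac)
  next
    case False
    \<comment> \<open>The exponents \<open>p / q\<close> and \<open>q / p\<close> are inverse to
      each other, so a pair missed by the first cutoff satisfies the second.\<close>
    then have "(F x powr (p / q)) powr (q / p) \<le> G y powr (q / p)"
      using pq by (intro powr_mono2) auto
    then have "F x \<le> G y powr (q / p)"
      using pq nonneg(1)[of x] by (simp add: powr_powr)
    then show ?thesis using nonneg[of x] nonneg[of y] by (simp add: mult_ac abs_minus_commute)
  qed
  have "(\<integral>\<^sup>+x. \<integral>\<^sup>+y. ennreal (F x * G y * \<bar>x - y\<bar> powr (\<alpha> - 1)) \<partial>lborel \<partial>lborel)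
     \<le> (\<integral>\<^sup>+x. \<integral>\<^sup>+y. ennreal (?A x y) + ennreal (?B x y) \<partial>lborel \<partial>lborel)"
    using pw nonneg by (intro nn_integral_mono) (simp flip: ennreal_plus)
  also have "\<dots> = (\<integral>\<^sup>+x. \<integral>\<^sup>+y. ennreal (?A x y) \<partial>lborel \<partial>lborel) + (\<integral>\<^sup>+x. \<integral>\<^sup>+y. ennreal (?B x y) \<partial>lborel \<partial>lborel)"
    by (simp add: nn_integral_add)
  also have "(\<integral>\<^sup>+x. \<integral>\<^sup>+y. ennreal (?B x y) \<partial>lborel \<partial>lborel) = (\<integral>\<^sup>+y. \<integral>\<^sup>+x. ennreal (?B x y) \<partial>lborel \<partial>lborel)"
    by (rule lborel_pair.Fubini'[symmetric]) simp
  finally show ?thesis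
    using half[OF assms(1,2) nonneg finF finG pq]
      half[OF assms(2,1) nonneg(2,1) finG finF pq(2,1)] pq(3)
    by (simp add: add.commute order_le_less_trans)
qed

text \<open>On the bounded interval \<open>t powr r\<close> is at most \<open>1 + t powr p\<close>.
  Outside it the integrand is \<open>0 powr r\<close>, which is 0 even for
  \<open>r = 0\<close>.\<close>

lemma nn_integral_powr_finite_mono:
  fixes F :: "real \<Rightarrow> real"
  assumes [measurable]: "F \<in> borel_measurable borel"
    and supp: "\<And>x. x \<notin> {a<..<b} \<Longrightarrow> F x = 0"
    and fin: "(\<integral>\<^sup>+x. ennreal (\<bar>F x\<bar> powr p) \<partial>lborel) < \<infinity>"
    and r: "0 \<le> r" "r \<le> p"
  shows "(\<integral>\<^sup>+x. ennreal (\<bar>F x\<bar> powr r) \<partial>lborel) < \<infinity>"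
proof -
  have pw: "\<bar>F x\<bar> powr r \<le> indicator {a<..<b} x + \<bar>F x\<bar> powr p" for x
  proof (cases "x \<in> {a<..<b} \<and> F x \<noteq> 0")
    case True
    show ?thesis
    proof (cases "\<bar>F x\<bar> \<le> 1")
      case True
      then have "\<bar>F x\<bar> powr r \<le> 1"
        using r by (simp add: powr_le1)
      then show ?thesis
        using \<open>x \<in> {a<..<b} \<and> F x \<noteq> 0\<close> by (auto intro: add_increasing2)
    next
      case False
      then have "\<bar>F x\<bar> powr r \<le> \<bar>F x\<bar> powr p"
        using r by (intro powr_mono) auto
      then show ?thesis
        by (simp add: add_increasing)
    qed
  qed (use supp in auto)
  have "(\<integral>\<^sup>+x. ennreal (\<bar>F x\<bar> powr r) \<partial>lborel)
      \<le> (\<integral>\<^sup>+x. indicator {a<..<b} x + ennreal (\<bar>F x\<bar> powr p) \<partial>lborel)"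
    using pw by (intro nn_integral_mono) (simp flip: ennreal_plus ennreal_indicator)
  also have "\<dots> = emeasure lborel {a<..<b} + (\<integral>\<^sup>+x. ennreal (\<bar>F x\<bar> powr p) \<partial>lborel)"
    by (subst nn_integral_add) auto
  also have "\<dots> < \<infinity>"
    using fin emeasure_bounded_finite[of "{a<..<b}"] by (simp add: bounded_Ioo)
  finally show ?thesis .
qed

text \<open>The regime opposite to \<open>truncated_potential_bound\<close>:
  \<open>1 / q < \<alpha>\<close> is equivalent to \<open>r > -1\<close>, so the kernel raised to
  the conjugate power is integrable near its singularity. By Young's inequality the potential of
  \<open>G\<close> is then bounded on the interval, and \<open>F\<close> need only be
  integrable.\<close>

lemma bounded_potential_finite:
  fixes F G :: "real \<Rightarrow> real" and \<alpha> q :: real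
  assumes [measurable]: "F \<in> borel_measurable borel" "G \<in> borel_measurable borel"
    and nonneg: "\<And>x. F x \<ge> 0" "\<And>y. G y \<ge> 0"
    and supp: "\<And>x. x \<notin> {a<..<b} \<Longrightarrow> F x = 0" "\<And>x. x \<notin> {a<..<b} \<Longrightarrow> G x = 0"
    and finF: "(\<integral>\<^sup>+x. ennreal (F x) \<partial>lborel) < \<infinity>"
    and finG: "(\<integral>\<^sup>+y. ennreal (G y powr q) \<partial>lborel) < \<infinity>"
    and q: "q > 1" "1 / q < \<alpha>"
  shows "(\<integral>\<^sup>+x. \<integral>\<^sup>+y. ennreal (F x * G y * \<bar>x - y\<bar> powr (\<alpha> - 1)) \<partial>lborel \<partial>lborel) < \<infinity>"
proof -
  define r where "r = (\<alpha> - 1) * (q / (q - 1))"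
  have r: "r > -1"
    using q unfolding r_def by (simp add: field_simps)
  define M where "M = 2 * (\<bar>b - a\<bar> powr (r + 1) / (r + 1))"
  have inner: "(\<integral>\<^sup>+y. ennreal (G y * \<bar>x - y\<bar> powr (\<alpha> - 1)) \<partial>lborel)
      \<le> (\<integral>\<^sup>+y. ennreal (G y powr q) \<partial>lborel) + ennreal M" if x: "x \<in> {a<..<b}" for x
  proof -
    have pw: "G y * \<bar>x - y\<bar> powr (\<alpha> - 1) \<le> G y powr q
        + \<bar>x - y\<bar> powr r * indicator {..\<bar>b - a\<bar>} \<bar>x - y\<bar>" for y
    proof (cases "y \<in> {a<..<b}")
      case True
      have "G y * \<bar>x - y\<bar> powr (\<alpha> - 1) \<le> G y powr q + (\<bar>x - y\<bar> powr (\<alpha> - 1)) powr (q / (q - 1))"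
        using nonneg q by (intro weak_Young) auto
      moreover have "\<bar>x - y\<bar> \<le> \<bar>b - a\<bar>"
        using True x by auto
      ultimately show ?thesis
        by (simp add: powr_powr r_def)
    qed (use supp in auto)
    have "(\<integral>\<^sup>+y. ennreal (G y * \<bar>x - y\<bar> powr (\<alpha> - 1)) \<partial>lborel)
      \<le> (\<integral>\<^sup>+y. ennreal (G y powr q) + ennreal (\<bar>x - y\<bar> powr r * indicator {..\<bar>b - a\<bar>} \<bar>x - y\<bar>) \<partial>lborel)"
      using pw by (intro nn_integral_mono) (simp flip: ennreal_plus)
    also have "\<dots> = (\<integral>\<^sup>+y. ennreal (G y powr q) \<partial>lborel)
        + (\<integral>\<^sup>+y. ennreal (\<bar>x - y\<bar> powr r * indicator {..\<bar>b - a\<bar>} \<bar>x - y\<bar>) \<partial>lborel)"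
      by (intro nn_integral_add) auto
    also have "\<dots> \<le> (\<integral>\<^sup>+y. ennreal (G y powr q) \<partial>lborel) + ennreal M"
      unfolding M_def by (intro add_left_mono nn_integral_abs_powr_near r) auto
    finally show ?thesis .
  qed
  have "(\<integral>\<^sup>+x. \<integral>\<^sup>+y. ennreal (F x * G y * \<bar>x - y\<bar> powr (\<alpha> - 1)) \<partial>lborel \<partial>lborel)
      = (\<integral>\<^sup>+x. ennreal (F x) * (\<integral>\<^sup>+y. ennreal (G y * \<bar>x - y\<bar> powr (\<alpha> - 1)) \<partial>lborel) \<partial>lborel)"
    using nonneg by (subst nn_integral_cmult[symmetric]) (auto simp: ennreal_mult mult.assoc)
  also have "\<dots> \<le> (\<integral>\<^sup>+x. ennreal (F x) * ((\<integral>\<^sup>+y. ennreal (G y powr q) \<partial>lborel) + ennreal M) \<partial>lborel)"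
  proof (intro nn_integral_mono)
    fix x
    show "ennreal (F x) * (\<integral>\<^sup>+y. ennreal (G y * \<bar>x - y\<bar> powr (\<alpha> - 1)) \<partial>lborel)
      \<le> ennreal (F x) * ((\<integral>\<^sup>+y. ennreal (G y powr q) \<partial>lborel) + ennreal M)"
      using supp(1)[of x] inner[of x] by (cases "x \<in> {a<..<b}") (auto intro: mult_left_mono)
  qed
  also have "\<dots> = (\<integral>\<^sup>+x. ennreal (F x) \<partial>lborel) * ((\<integral>\<^sup>+y. ennreal (G y powr q) \<partial>lborel) + ennreal M)"
    by (intro nn_integral_multc) simp
  also have "\<dots> < \<infinity>"
    using finF finG by (simp add: ennreal_mult_less_top)
  finally show ?thesis .
qed

lemma fractional_kernel_finite:
  fixes F G :: "real \<Rightarrow> real" and \<alpha> p q :: real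
  assumes meas [measurable]: "F \<in> borel_measurable borel" "G \<in> borel_measurable borel"
    and supp: "\<And>x. x \<notin> {a<..<b} \<Longrightarrow> F x = 0" "\<And>x. x \<notin> {a<..<b} \<Longrightarrow> G x = 0"
    and finF: "(\<integral>\<^sup>+x. ennreal (\<bar>F x\<bar> powr p) \<partial>lborel) < \<infinity>"
    and finG: "(\<integral>\<^sup>+y. ennreal (\<bar>G y\<bar> powr q) \<partial>lborel) < \<infinity>"
    and \<alpha>: "0 < \<alpha>" "\<alpha> < 1" and pq: "p \<ge> 1" "q \<ge> 1" "1 / p + 1 / q \<le> 1 + \<alpha>"
      "1 / p + 1 / q = 1 + \<alpha> \<Longrightarrow> p \<noteq> 1 \<and> q \<noteq> 1"
  shows "(\<integral>\<^sup>+x. \<integral>\<^sup>+y. ennreal (\<bar>F x\<bar> * \<bar>G y\<bar> * \<bar>x - y\<bar> powr (\<alpha> - 1)) \<partial>lborel \<partial>lborel) < \<infinity>"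
proof -
  consider "p = 1" | "q = 1" | "p > 1" "q > 1"
    using pq by linarith
  then show ?thesis
  proof cases
    case 1
    \<comment> \<open>With \<open>p = 1\<close> the hypothesis reads
      \<open>1 / q \<le> \<alpha>\<close>, and equality is the excluded critical case.\<close>
    then have q: "1 / q < \<alpha>" using pq by (auto simp: less_le)
    moreover have "q > 1" using q \<alpha> pq by (cases "q = 1") auto
    ultimately show ?thesis
      using 1 finF finG supp
      by (intro bounded_potential_finite[where q = q and a = a and b = b]) auto
  next
    case 2
    then have p: "1 / p < \<alpha>" using pq by (auto simp: less_le)
    moreover have "p > 1" using p \<alpha> pq by (cases "p = 1") auto
    ultimately have "(\<integral>\<^sup>+y. \<integral>\<^sup>+x. ennreal (\<bar>G y\<bar> * \<bar>F x\<bar> * \<bar>y - x\<bar> powr (\<alpha> - 1)) \<partial>lborel \<partial>lborel) < \<infinity>"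
      using 2 finF finG supp
      by (intro bounded_potential_finite[where q = p and a = a and b = b]) auto
    then show ?thesis
      by (subst lborel_pair.Fubini'[symmetric]) (auto simp: mult.commute abs_minus_commute)
  next
    case 3
    define S where "S = 1 / p + 1 / q"
    \<comment> \<open>The point (1/p, 1/q) is moved the fraction \<theta> of the way towards (1, 1).
      The sum of the coordinates goes from \<open>S\<close> to
      \<open>S + \<theta> * (2 - S)\<close>, and \<theta> makes this equal to
      \<open>1 + \<alpha>\<close>; \<open>\<theta> < 1\<close> keeps both new exponents above
      1.\<close>
    define \<theta> where "\<theta> = (1 + \<alpha> - S) / (2 - S)"
    have S: "S \<le> 1 + \<alpha>" "2 - S > 0"
      using pq(3) \<alpha> unfolding S_def by auto
    have \<theta>: "0 \<le> \<theta>" "\<theta> < 1"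
      using S \<alpha> unfolding \<theta>_def by auto
    define p' where "p' = 1 / (1 / p + \<theta> * (1 - 1 / p))"
    define q' where "q' = 1 / (1 / q + \<theta> * (1 - 1 / q))"
    have shrink: "1 < 1 / (1 / s + \<theta> * (1 - 1 / s)) \<and> 1 / (1 / s + \<theta> * (1 - 1 / s)) \<le> s"
      if s: "s > 1" for s :: real
    proof -
      have "\<theta> * (1 - 1 / s) < 1 * (1 - 1 / s)" "0 \<le> \<theta> * (1 - 1 / s)"
        using \<theta> s by (intro mult_strict_right_mono mult_nonneg_nonneg; simp)+
      then have *: "1 / s + \<theta> * (1 - 1 / s) < 1" "1 / s \<le> 1 / s + \<theta> * (1 - 1 / s)" by auto
      moreover have pos: "0 < 1 / s" using s by simp
      ultimately have "1 / (1 / s + \<theta> * (1 - 1 / s)) \<le> 1 / (1 / s)"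
        by (intro divide_left_mono mult_pos_pos) linarith+
      moreover have "1 < 1 / (1 / s + \<theta> * (1 - 1 / s))"
        using * pos by (subst less_divide_eq_1_pos) linarith+
      ultimately show ?thesis by simp
    qed
    have p': "1 < p'" "p' \<le> p" and q': "1 < q'" "q' \<le> q"
      using shrink 3 unfolding p'_def q'_def by auto
    have "1 / p' + 1 / q' = S + \<theta> * (2 - S)"
      unfolding p'_def q'_def S_def by (simp add: algebra_simps)
    also have "\<dots> = 1 + \<alpha>"
      using S unfolding \<theta>_def by simp
    finally have "1 / p' + 1 / q' = 1 + \<alpha>" .
    moreover have "(\<integral>\<^sup>+x. ennreal (\<bar>F x\<bar> powr p') \<partial>lborel) < \<infinity>"
      by (rule nn_integral_powr_finite_mono[OF meas(1) supp(1) finF]) (use p' in auto)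
    moreover have "(\<integral>\<^sup>+y. ennreal (\<bar>G y\<bar> powr q') \<partial>lborel) < \<infinity>"
      by (rule nn_integral_powr_finite_mono[OF meas(2) supp(2) finG]) (use q' in auto)
    ultimately show ?thesis
      using p' q' \<alpha>
      by (intro Hardy_Littlewood_Sobolev_finite[where p = p' and q = q']) auto
  qed
qed

section \<open>Fractional integration by parts for Borel functions\<close>

lemma
  fixes \<phi> \<psi> :: "real \<Rightarrow> real" and \<alpha> :: real
  assumes [measurable]: "\<phi> \<in> borel_measurable borel" "\<psi> \<in> borel_measurable borel"
    and supp: "\<And>x. x \<notin> {a<..<b} \<Longrightarrow> \<phi> x = 0" "\<And>x. x \<notin> {a<..<b} \<Longrightarrow> \<psi> x = 0"
    and \<alpha>: "\<alpha> > 0"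
    and fin: "(\<integral>\<^sup>+x. \<integral>\<^sup>+y. ennreal (\<bar>\<phi> x\<bar> * \<bar>\<psi> y\<bar> * \<bar>x - y\<bar> powr (\<alpha> - 1)) \<partial>lborel \<partial>lborel) < \<infinity>"
  shows integrable_mult_RL_int_left: "integrable lborel (\<lambda>x. \<phi> x * RL_int_left \<alpha> a \<psi> x)" (is ?L)
    and integrable_RL_int_right_mult: "integrable lborel (\<lambda>x. RL_int_right \<alpha> b \<phi> x * \<psi> x)" (is ?R)
    and integral_RL_int_by_parts: "(\<integral>x. \<phi> x * RL_int_left \<alpha> a \<psi> x \<partial>lborel)
          = (\<integral>x. RL_int_right \<alpha> b \<phi> x * \<psi> x \<partial>lborel)" (is ?E)
proof -
  define h where "h = (\<lambda>x y. \<phi> x * \<psi> y * (if y < x then (x - y) powr (\<alpha> - 1) else 0))"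
  have [measurable]: "case_prod h \<in> borel_measurable (lborel \<Otimes>\<^sub>M lborel)"
    unfolding h_def by measurable
  have "(\<integral>\<^sup>+x. \<integral>\<^sup>+y. ennreal (norm (h x y)) \<partial>lborel \<partial>lborel)
      \<le> (\<integral>\<^sup>+x. \<integral>\<^sup>+y. ennreal (\<bar>\<phi> x\<bar> * \<bar>\<psi> y\<bar> * \<bar>x - y\<bar> powr (\<alpha> - 1)) \<partial>lborel \<partial>lborel)"
    unfolding h_def by (intro nn_integral_mono ennreal_leI) (auto simp: abs_mult)
  then have "(\<integral>\<^sup>+z. ennreal (norm (case_prod h z)) \<partial>(lborel \<Otimes>\<^sub>M lborel)) < \<infinity>"
    using fin by (subst lborel.nn_integral_fst[symmetric]) (auto intro: order_le_less_trans)
  then have int: "integrable (lborel \<Otimes>\<^sub>M lborel) (case_prod h)"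
    by (intro integrableI_bounded) auto
  have left: "(\<integral>y. h x y \<partial>lborel) = Gamma \<alpha> * (\<phi> x * RL_int_left \<alpha> a \<psi> x)" for x
  proof -
    have "(\<integral>y. h x y \<partial>lborel) = (\<integral>y. \<phi> x * (indicator {a<..<x} y *\<^sub>R ((x - y) powr (\<alpha> - 1) * \<psi> y)) \<partial>lborel)"
      using supp(2) by (intro Bochner_Integration.integral_cong) (auto simp: h_def indicator_def)
    also have "\<dots> = \<phi> x * (LINT y:{a<..<x}|lborel. (x - y) powr (\<alpha> - 1) * \<psi> y)"
      unfolding set_lebesgue_integral_def by simp
    also have "(LINT y:{a<..<x}|lborel. (x - y) powr (\<alpha> - 1) * \<psi> y)
        = (LINT y:{a<..<x}|lebesgue. (x - y) powr (\<alpha> - 1) * \<psi> y)"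
      unfolding set_lebesgue_integral_def by (subst integral_completion) auto
    finally show ?thesis
      using Gamma_real_pos[OF \<alpha>] by (simp add: RL_int_left_def)
  qed
  have right: "(\<integral>x. h x y \<partial>lborel) = Gamma \<alpha> * (RL_int_right \<alpha> b \<phi> y * \<psi> y)" for y
  proof -
    have "(\<integral>x. h x y \<partial>lborel) = (\<integral>x. \<psi> y * (indicator {y<..<b} x *\<^sub>R ((x - y) powr (\<alpha> - 1) * \<phi> x)) \<partial>lborel)"
      using supp(1) by (intro Bochner_Integration.integral_cong) (auto simp: h_def indicator_def)
    also have "\<dots> = \<psi> y * (LINT x:{y<..<b}|lborel. (x - y) powr (\<alpha> - 1) * \<phi> x)"
      unfolding set_lebesgue_integral_def by simp
    also have "(LINT x:{y<..<b}|lborel. (x - y) powr (\<alpha> - 1) * \<phi> x)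
        = (LINT x:{y<..<b}|lebesgue. (x - y) powr (\<alpha> - 1) * \<phi> x)"
      unfolding set_lebesgue_integral_def by (subst integral_completion) auto
    finally show ?thesis
      using Gamma_real_pos[OF \<alpha>] by (simp add: RL_int_right_def)
  qed
  have G: "Gamma \<alpha> \<noteq> 0"
    using Gamma_real_pos[OF \<alpha>] by simp
  show ?L
    using lborel_pair.integrable_fst[OF int] G unfolding left by simp
  show ?R
    using lborel_pair.integrable_snd[OF int] G unfolding right by simp
  have "(\<integral>x. Gamma \<alpha> * (\<phi> x * RL_int_left \<alpha> a \<psi> x) \<partial>lborel)
      = (\<integral>x. Gamma \<alpha> * (RL_int_right \<alpha> b \<phi> x * \<psi> x) \<partial>lborel)"
    using lborel_pair.integral_fst[OF int] lborel_pair.integral_snd[OF int]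
    unfolding left right by (rule trans[OF _ sym])
  then show ?E
    unfolding integral_mult_right_zero using G by simp
qed

subsection \<open>The Mittag-Leffler kernel\<close>

text \<open>Wendel's inequality. It follows from log-convexity of Gamma, because
  \<open>x + 1\<close> is the combination of \<open>x + \<alpha>\<close> and
  \<open>x + \<alpha> + 1\<close> with weights \<open>\<alpha>\<close> and
  \<open>1 - \<alpha>\<close>; the functional equation then reduces everything to
  \<open>Gamma x\<close> and \<open>Gamma (x + \<alpha>)\<close>.\<close>

lemma Gamma_ratio_le:
  fixes x \<alpha> :: real
  assumes x: "x > 0" and \<alpha>: "0 < \<alpha>" "\<alpha> < 1"
  shows "Gamma x / Gamma (x + \<alpha>) \<le> (x + \<alpha>) powr (1 - \<alpha>) / x"
proof -
  have pos: "Gamma x > 0" "Gamma (x + \<alpha>) > 0"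
    using x \<alpha> by (auto intro: Gamma_real_pos)
  have "ln (Gamma (\<alpha> * (x + \<alpha>) + (1 - \<alpha>) * (x + \<alpha> + 1)))
      \<le> \<alpha> * ln (Gamma (x + \<alpha>)) + (1 - \<alpha>) * ln (Gamma (x + \<alpha> + 1))"
    using convex_onD[OF log_convex_Gamma_real, of "1 - \<alpha>" "x + \<alpha>" "x + \<alpha> + 1"] x \<alpha> by simp
  also have "\<alpha> * (x + \<alpha>) + (1 - \<alpha>) * (x + \<alpha> + 1) = x + 1"
    by (simp add: algebra_simps)
  also have "Gamma (x + \<alpha> + 1) = (x + \<alpha>) * Gamma (x + \<alpha>)"
    using x \<alpha> by (intro Gamma_plus1) auto
  also have "Gamma (x + 1) = x * Gamma x"
    using x by (intro Gamma_plus1) auto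
  also have "\<alpha> * ln (Gamma (x + \<alpha>)) + (1 - \<alpha>) * ln ((x + \<alpha>) * Gamma (x + \<alpha>))
      = ln ((x + \<alpha>) powr (1 - \<alpha>) * Gamma (x + \<alpha>))"
  proof -
    have "ln ((x + \<alpha>) * Gamma (x + \<alpha>)) = ln (x + \<alpha>) + ln (Gamma (x + \<alpha>))"
      using x \<alpha> pos by (intro ln_mult_pos) auto
    moreover have "ln ((x + \<alpha>) powr (1 - \<alpha>) * Gamma (x + \<alpha>)) = ln ((x + \<alpha>) powr (1 - \<alpha>)) + ln (Gamma (x + \<alpha>))"
      using x \<alpha> pos by (intro ln_mult_pos) auto
    ultimately show ?thesis
      by (simp add: ln_powr algebra_simps)
  qed
  finally have "x * Gamma x \<le> (x + \<alpha>) powr (1 - \<alpha>) * Gamma (x + \<alpha>)"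
    using x \<alpha> pos by (subst (asm) ln_le_cancel_iff) auto
  then show ?thesis
    using x pos by (simp add: field_simps)
qed

text \<open>Ratio test: passing from \<open>k\<close> to \<open>k + 1\<close> shifts the Gamma
  argument by \<alpha>, so by \<open>Gamma_ratio_le\<close> consecutive terms have a ratio of order
  \<open>x powr (- \<alpha>)\<close> with \<open>x = \<alpha> * real k + 1\<close>.\<close>

lemma summable_mittag_leffler:
  fixes \<alpha> z :: real
  assumes \<alpha>: "0 < \<alpha>" "\<alpha> < 1"
  shows "summable (\<lambda>k. norm (z ^ k / Gamma (\<alpha> * real k + 1)))"
proof -
  have "filterlim (\<lambda>k. 1 + \<alpha> * real k) at_top sequentially"
    using \<alpha> by (intro filterlim_tendsto_add_at_top[OF tendsto_const]
        filterlim_tendsto_pos_mult_at_top[OF tendsto_const] filterlim_real_sequentially) auto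
  then have lim: "filterlim (\<lambda>k. \<alpha> * real k + 1) at_top sequentially"
    by (simp add: add.commute)
  \<comment> \<open>The factor 2 absorbs \<open>x + \<alpha> \<le> 2 * x\<close>, valid since
    \<open>x \<ge> 1\<close>, together with \<open>2 powr (1 - \<alpha>) \<le> 2\<close>.\<close>
  have "(\<lambda>k. \<bar>z\<bar> * (2 * (\<alpha> * real k + 1) powr (- \<alpha>))) \<longlonglongrightarrow> \<bar>z\<bar> * (2 * 0)"
    using \<alpha> by (intro tendsto_mult tendsto_const tendsto_neg_powr lim) auto
  then have "eventually (\<lambda>k. \<bar>z\<bar> * (2 * (\<alpha> * real k + 1) powr (- \<alpha>)) < 1 / 2) sequentially"
    by (intro order_tendstoD) auto
  then obtain N where N: "\<And>k. k \<ge> N \<Longrightarrow> \<bar>z\<bar> * (2 * (\<alpha> * real k + 1) powr (- \<alpha>)) < 1 / 2"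
    by (auto simp: eventually_at_top_linorder)
  show ?thesis
  proof (rule summable_ratio_test[of "1 / 2" N])
    fix k assume k: "k \<ge> N"
    define x where "x = \<alpha> * real k + 1"
    have x: "x \<ge> 1" using \<alpha> unfolding x_def by simp
    have pos: "Gamma x > 0" "Gamma (x + \<alpha>) > 0"
      using x \<alpha> by (auto intro: Gamma_real_pos)
    have "Gamma x / Gamma (x + \<alpha>) \<le> (x + \<alpha>) powr (1 - \<alpha>) / x"
      using x \<alpha> by (intro Gamma_ratio_le) auto
    also have "\<dots> \<le> (2 * x) powr (1 - \<alpha>) / x"
      using x \<alpha> by (intro divide_right_mono powr_mono2) auto
    also have "\<dots> = 2 powr (1 - \<alpha>) * x powr (- \<alpha>)"
      using x by (simp add: powr_mult powr_diff powr_minus field_simps)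
    also have "\<dots> \<le> 2 powr 1 * x powr (- \<alpha>)"
      using \<alpha> by (intro mult_right_mono powr_mono) auto
    finally have "\<bar>z\<bar> * (Gamma x / Gamma (x + \<alpha>)) \<le> \<bar>z\<bar> * (2 * x powr (- \<alpha>))"
      by (intro mult_left_mono) auto
    also have "\<dots> \<le> 1 / 2"
      using N[OF k] unfolding x_def by simp
    finally have ratio: "\<bar>z\<bar> * (Gamma x / Gamma (x + \<alpha>)) \<le> 1 / 2" .
    have "\<alpha> * real (Suc k) + 1 = x + \<alpha>"
      unfolding x_def by (simp add: algebra_simps)
    then have "norm (norm (z ^ Suc k / Gamma (\<alpha> * real (Suc k) + 1)))
        = \<bar>z\<bar> * (Gamma x / Gamma (x + \<alpha>)) * (\<bar>z\<bar> ^ k / Gamma x)"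
      using pos by (simp add: abs_mult power_abs)
    also have "\<dots> \<le> 1 / 2 * (\<bar>z\<bar> ^ k / Gamma x)"
      using pos by (intro mult_right_mono ratio) auto
    also have "\<bar>z\<bar> ^ k / Gamma x = norm (norm (z ^ k / Gamma (\<alpha> * real k + 1)))"
      using pos unfolding x_def by (simp add: power_abs)
    finally show "norm (norm (z ^ Suc k / Gamma (\<alpha> * real (Suc k) + 1)))
      \<le> 1 / 2 * norm (norm (z ^ k / Gamma (\<alpha> * real k + 1)))" .
  qed simp
qed

lemma borel_measurable_mittag_leffler [measurable]: "mittag_leffler \<alpha> \<in> borel_measurable borel"
  unfolding mittag_leffler_def[abs_def] by measurable

text \<open>All coefficients are positive, so the series at \<open>R\<close> is a termwise majorant.
  It supplies a bound for the kernel that is uniform on an interval, which puts the truncated kernel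
  into every L_r.\<close>

lemma abs_mittag_leffler_le:
  assumes \<alpha>: "0 < \<alpha>" "\<alpha> < 1" and z: "\<bar>z\<bar> \<le> R"
  shows "\<bar>mittag_leffler \<alpha> z\<bar> \<le> mittag_leffler \<alpha> R"
proof -
  have R: "R \<ge> 0" using z by simp
  have pos: "Gamma (\<alpha> * real k + 1) > 0" for k
    using \<alpha> by (intro Gamma_real_pos add_nonneg_pos) auto
  have "\<bar>mittag_leffler \<alpha> z\<bar> \<le> (\<Sum>k. norm (z ^ k / Gamma (\<alpha> * real k + 1)))"
    unfolding mittag_leffler_def using summable_norm[OF summable_mittag_leffler[OF \<alpha>]] by simp
  also have "\<dots> \<le> (\<Sum>k. R ^ k / Gamma (\<alpha> * real k + 1))"
  proof (intro suminf_le summable_mittag_leffler \<alpha>)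
    show "norm (z ^ k / Gamma (\<alpha> * real k + 1)) \<le> R ^ k / Gamma (\<alpha> * real k + 1)" for k
      using pos[of k] z by (auto simp: power_abs intro!: divide_right_mono power_mono)
    show "summable (\<lambda>k. R ^ k / Gamma (\<alpha> * real k + 1))"
      using summable_mittag_leffler[OF \<alpha>, of R] by (rule summable_norm_cancel)
  qed
  finally show ?thesis unfolding mittag_leffler_def .
qed

lemma mittag_leffler_shift_sums:
  assumes \<alpha>: "0 < \<alpha>" "\<alpha> < 1"
  shows "(\<lambda>k. z ^ Suc k / Gamma (\<alpha> * real (Suc k) + 1)) sums (mittag_leffler \<alpha> z - 1)"
proof -
  have "(\<lambda>k. z ^ k / Gamma (\<alpha> * real k + 1)) sums mittag_leffler \<alpha> z"
    unfolding mittag_leffler_def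
    by (rule summable_sums[OF summable_norm_cancel[OF summable_mittag_leffler[OF \<alpha>]]])
  then show ?thesis
    by (subst sums_Suc_iff) simp
qed

section \<open>Beta integrals and the fractional integral of the kernel\<close>

lemma integral_Beta_lborel:
  assumes "x > 0" "y > (0::real)"
  shows "has_bochner_integral lborel
    (\<lambda>r. indicator {0<..<1} r * (r powr (x - 1) * (1 - r) powr (y - 1))) (Beta x y)"
proof -
  have int: "integrable lborel (\<lambda>r. indicator {0..1} r *\<^sub>R (r powr (x - 1) * (1 - r) powr (y - 1)))"
    using integrable_Beta[OF assms] unfolding set_integrable_def .
  have "(\<integral>r. indicator {0..1} r *\<^sub>R (r powr (x - 1) * (1 - r) powr (y - 1)) \<partial>lborel) = Beta x y"
    using set_borel_integral_eq_integral(2)[OF integrable_Beta[OF assms]]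
      integral_unique[OF has_integral_Beta_real[OF assms]]
    unfolding set_lebesgue_integral_def by simp
  with int have "has_bochner_integral lborel
      (\<lambda>r. indicator {0..1} r *\<^sub>R (r powr (x - 1) * (1 - r) powr (y - 1))) (Beta x y)"
    by (metis has_bochner_integral_iff)
  \<comment> \<open>Since \<open>0 powr y = 0\<close> for every \<open>y\<close>, the integrand
    vanishes at both endpoints, so the functions agree everywhere and not just almost
    everywhere.\<close>
  moreover have "(\<lambda>r::real. indicator {0..1} r *\<^sub>R (r powr (x - 1) * (1 - r) powr (y - 1)))
      = (\<lambda>r. indicator {0<..<1} r * (r powr (x - 1) * (1 - r) powr (y - 1)))"
    by (auto simp: indicator_def fun_eq_iff)
  ultimately show ?thesis by simp
qed

text \<open>The Beta integral turns the Gamma denominator of index \<open>k\<close> into that of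
  index \<open>k + 1\<close>. The factor \<open>c\<close> in front raises the power of
  \<open>c\<close> to match, and what remains is the Mittag-Leffler series without its constant
  term.\<close>

lemma integral_mittag_leffler_kernel:
  fixes \<alpha> c :: real
  assumes \<alpha>: "0 < \<alpha>" "\<alpha> < 1"
  shows "c * (\<integral>r. indicator {0<..<1} r * ((1 - r) powr (\<alpha> - 1) * mittag_leffler \<alpha> (c * r powr \<alpha>)) \<partial>lborel)
    = Gamma \<alpha> * (mittag_leffler \<alpha> c - 1)"
proof -
  define f where "f = (\<lambda>k r. c ^ k / Gamma (\<alpha> * real k + 1) *
    (indicator {0<..<1} r * (r powr (\<alpha> * real k + 1 - 1) * (1 - r) powr (\<alpha> - 1))))"
  have pos: "Gamma (\<alpha> * real k + 1) > 0" for k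
    using \<alpha> by (intro Gamma_real_pos add_nonneg_pos) auto
  have B: "has_bochner_integral lborel (\<lambda>r. indicator {0<..<1} r *
      (r powr (\<alpha> * real k + 1 - 1) * (1 - r) powr (\<alpha> - 1))) (Beta (\<alpha> * real k + 1) \<alpha>)" for k
    using \<alpha> by (intro integral_Beta_lborel add_nonneg_pos) auto
  have Beta: "Beta (\<alpha> * real k + 1) \<alpha> / Gamma (\<alpha> * real k + 1)
      = Gamma \<alpha> / Gamma (\<alpha> * real (Suc k) + 1)" for k
  proof -
    have e: "\<alpha> * real (Suc k) + 1 = \<alpha> * real k + 1 + \<alpha>" by (simp add: algebra_simps)
    have "Gamma (\<alpha> * real k + 1) * Gamma \<alpha> = Beta (\<alpha> * real k + 1) \<alpha> * Gamma (\<alpha> * real (Suc k) + 1)"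
      unfolding e
    proof (rule Gamma_Gamma_Beta)
      have "\<alpha> * real k + 1 + \<alpha> > 0" using \<alpha> by (simp add: add_pos_nonneg add_nonneg_pos)
      then show "\<alpha> * real k + 1 + \<alpha> \<notin> \<int>\<^sub>\<le>\<^sub>0"
        by (metis nonpos_Ints_nonpos not_le)
    qed
    then show ?thesis
      using pos[of k] pos[of "Suc k"] by (simp add: field_simps)
  qed
  have int: "integrable lborel (f k)" for k
    unfolding f_def using B[of k] by (intro integrable_mult_right) (auto dest: integrable.intros)
  have If: "(\<integral>r. f k r \<partial>lborel) = c ^ k * (Gamma \<alpha> / Gamma (\<alpha> * real (Suc k) + 1))" for k
  proof -
    have "(\<integral>r. f k r \<partial>lborel) = c ^ k * (Beta (\<alpha> * real k + 1) \<alpha> / Gamma (\<alpha> * real k + 1))"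
      unfolding f_def using has_bochner_integral_integral_eq[OF B[of k]] by simp
    then show ?thesis unfolding Beta .
  qed
  have Inf: "(\<integral>r. norm (f k r) \<partial>lborel) = \<bar>c\<bar> ^ k * (Gamma \<alpha> / Gamma (\<alpha> * real (Suc k) + 1))" for k
  proof -
    have "norm (f k r) = \<bar>c\<bar> ^ k / Gamma (\<alpha> * real k + 1) *
       (indicator {0<..<1} r * (r powr (\<alpha> * real k + 1 - 1) * (1 - r) powr (\<alpha> - 1)))" for r
      unfolding f_def using pos[of k] by (simp add: abs_mult power_abs)
    then have "(\<integral>r. norm (f k r) \<partial>lborel)
        = \<bar>c\<bar> ^ k * (Beta (\<alpha> * real k + 1) \<alpha> / Gamma (\<alpha> * real k + 1))"
      using has_bochner_integral_integral_eq[OF B[of k]] by simp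
    then show ?thesis unfolding Beta .
  qed
  have sum_f: "f k r = indicator {0<..<1} r * (1 - r) powr (\<alpha> - 1) *
      ((c * r powr \<alpha>) ^ k / Gamma (\<alpha> * real k + 1))" for k r
    unfolding f_def by (auto simp: indicator_def power_mult_distrib powr_power mult_ac)
  \<comment> \<open>The power of \<open>\<bar>c\<bar>\<close> lags one behind the Gamma index, so
    convergence comes from dividing the shifted series by \<open>\<bar>c\<bar>\<close>. For
    \<open>c = 0\<close> only the term \<open>k = 0\<close> survives.\<close>
  have summ: "summable (\<lambda>k. \<integral>r. norm (f k r) \<partial>lborel)"
  proof (cases "c = 0")
    case False
    have "summable (\<lambda>k. \<bar>c\<bar> ^ Suc k / Gamma (\<alpha> * real (Suc k) + 1))"
      using mittag_leffler_shift_sums[OF \<alpha>] by (rule sums_summable)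
    then have "summable (\<lambda>k. Gamma \<alpha> / \<bar>c\<bar> * (\<bar>c\<bar> ^ Suc k / Gamma (\<alpha> * real (Suc k) + 1)))"
      by (rule summable_mult)
    then show ?thesis
      unfolding Inf using False by (simp add: field_simps)
  next
    case True
    then show ?thesis
      unfolding Inf by (intro summable_finite[of "{0}"]) auto
  qed
  have "(\<lambda>k. \<integral>r. f k r \<partial>lborel) sums (\<integral>r. (\<Sum>k. f k r) \<partial>lborel)"
  proof (rule sums_integral[OF int _ summ], intro AE_I2)
    show "summable (\<lambda>k. norm (f k r))" for r
      unfolding sum_f norm_mult[of _ "_ / _"] by (intro summable_mult summable_mittag_leffler \<alpha>)
  qed
  also have "(\<lambda>r. \<Sum>k. f k r) = (\<lambda>r. indicator {0<..<1} r * ((1 - r) powr (\<alpha> - 1) * mittag_leffler \<alpha> (c * r powr \<alpha>)))"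
    unfolding sum_f mittag_leffler_def
    by (subst suminf_mult) (simp_all add: mult.assoc summable_norm_cancel[OF summable_mittag_leffler[OF \<alpha>]])
  finally have "(\<lambda>k. c * (c ^ k * (Gamma \<alpha> / Gamma (\<alpha> * real (Suc k) + 1)))) sums
    (c * (\<integral>r. indicator {0<..<1} r * ((1 - r) powr (\<alpha> - 1) * mittag_leffler \<alpha> (c * r powr \<alpha>)) \<partial>lborel))"
    unfolding If by (rule sums_mult)
  moreover have "(\<lambda>k. Gamma \<alpha> * (c ^ Suc k / Gamma (\<alpha> * real (Suc k) + 1))) sums (Gamma \<alpha> * (mittag_leffler \<alpha> c - 1))"
    by (intro sums_mult mittag_leffler_shift_sums \<alpha>)
  ultimately show ?thesis
    by (auto simp: mult_ac intro: sums_unique2)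
qed

text \<open>The normal form to which the substitutions \<open>a + u * r\<close> and
  \<open>b - u * r\<close> reduce the left and the right integral. The Jacobian \<open>u\<close> and
  the kernel factor \<open>u powr (\<alpha> - 1)\<close> combine to \<open>u powr \<alpha>\<close>,
  which is \<open>- c / l\<close>.\<close>

lemma integral_mittag_leffler_scaled:
  fixes \<alpha> l u :: real
  assumes \<alpha>: "0 < \<alpha>" "\<alpha> < 1" and l: "l \<noteq> 0" and u: "u > 0"
  shows "1 / Gamma \<alpha> * (u * (\<integral>r. indicator {0<..<1} r *
      ((u - u * r) powr (\<alpha> - 1) * mittag_leffler \<alpha> (- l * (u * r) powr \<alpha>)) \<partial>lborel))
    = (1 - mittag_leffler \<alpha> (- l * u powr \<alpha>)) / l"
proof -
  define c where "c = - l * u powr \<alpha>"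
  define J where "J = (\<integral>r. indicator {0<..<1} r *
      ((1 - r) powr (\<alpha> - 1) * mittag_leffler \<alpha> (c * r powr \<alpha>)) \<partial>lborel)"
  have "(\<integral>r. indicator {0<..<1} r *
      ((u - u * r) powr (\<alpha> - 1) * mittag_leffler \<alpha> (- l * (u * r) powr \<alpha>)) \<partial>lborel)
    = (\<integral>r. u powr (\<alpha> - 1) * (indicator {0<..<1} r *
      ((1 - r) powr (\<alpha> - 1) * mittag_leffler \<alpha> (c * r powr \<alpha>))) \<partial>lborel)"
  proof (intro Bochner_Integration.integral_cong refl)
    fix r :: real
    show "indicator {0<..<1} r * ((u - u * r) powr (\<alpha> - 1) * mittag_leffler \<alpha> (- l * (u * r) powr \<alpha>))
      = u powr (\<alpha> - 1) * (indicator {0<..<1} r *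
      ((1 - r) powr (\<alpha> - 1) * mittag_leffler \<alpha> (c * r powr \<alpha>)))"
    proof (cases "r \<in> {0<..<1}")
      case True
      have "(u - u * r) powr (\<alpha> - 1) = u powr (\<alpha> - 1) * (1 - r) powr (\<alpha> - 1)"
        using True u by (subst powr_mult[symmetric]) (auto simp: algebra_simps)
      moreover have "- l * (u * r) powr \<alpha> = c * r powr \<alpha>"
        using True u unfolding c_def by (simp add: powr_mult)
      ultimately show ?thesis by simp
    qed simp
  qed
  also have "\<dots> = u powr (\<alpha> - 1) * J"
    unfolding J_def by simp
  finally have 1: "u * (\<integral>r. indicator {0<..<1} r *
      ((u - u * r) powr (\<alpha> - 1) * mittag_leffler \<alpha> (- l * (u * r) powr \<alpha>)) \<partial>lborel) = u powr \<alpha> * J"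
    using u by (simp add: powr_mult_base)
  have "c * J = Gamma \<alpha> * (mittag_leffler \<alpha> c - 1)"
    using integral_mittag_leffler_kernel[OF \<alpha>, of c] unfolding J_def .
  moreover have "c * J = - l * (u powr \<alpha> * J)"
    unfolding c_def by simp
  ultimately have "- l * (u powr \<alpha> * J) = Gamma \<alpha> * (mittag_leffler \<alpha> c - 1)" by simp
  then show ?thesis
    unfolding 1 c_def[symmetric] using l Gamma_real_pos[OF \<alpha>(1)] by (simp add: field_simps)
qed

text \<open>This is needed for the right derivative: there the kernel is anchored at the left
  endpoint of the range of integration, and Fubini turns the right integral of the function into a
  left integral of the kernel. The right-hand version below serves the left derivative.\<close>

lemma RL_int_left_mittag_leffler:
  fixes \<alpha> l :: real
  assumes \<alpha>: "0 < \<alpha>" "\<alpha> < 1" and l: "l \<noteq> 0" and t: "a < t"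
  shows "RL_int_left \<alpha> a (\<lambda>x. mittag_leffler \<alpha> (- l * (x - a) powr \<alpha>)) t
    = (1 - mittag_leffler \<alpha> (- l * (t - a) powr \<alpha>)) / l"
proof -
  define u where "u = t - a"
  have u: "u > 0" using t unfolding u_def by simp
  have "(LINT s:{a<..<t}|lebesgue. (t - s) powr (\<alpha> - 1) * mittag_leffler \<alpha> (- l * (s - a) powr \<alpha>))
     = (\<integral>s. indicator {a<..<t} s *\<^sub>R ((t - s) powr (\<alpha> - 1) * mittag_leffler \<alpha> (- l * (s - a) powr \<alpha>)) \<partial>lborel)"
    unfolding set_lebesgue_integral_def by (subst integral_completion) auto
  also have "\<dots> = u * (\<integral>r. indicator {a<..<t} (a + u * r) *\<^sub>R
      ((t - (a + u * r)) powr (\<alpha> - 1) * mittag_leffler \<alpha> (- l * (a + u * r - a) powr \<alpha>)) \<partial>lborel)"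
    using u by (subst lborel_integral_real_affine[where c = u and t = a]) auto
  also have "(\<lambda>r. indicator {a<..<t} (a + u * r) *\<^sub>R
      ((t - (a + u * r)) powr (\<alpha> - 1) * mittag_leffler \<alpha> (- l * (a + u * r - a) powr \<alpha>)))
    = (\<lambda>r. indicator {0<..<1} r * ((u - u * r) powr (\<alpha> - 1) * mittag_leffler \<alpha> (- l * (u * r) powr \<alpha>)))"
  proof
    fix r
    have "a + u * r \<in> {a<..<t} \<longleftrightarrow> 0 < u * r \<and> u * r < u"
      by (intro iffI conjI; use u_def in \<open>simp only: greaterThanLessThan_iff, linarith\<close>)
    also have "\<dots> \<longleftrightarrow> r \<in> {0<..<1}"
      using u by (auto simp: zero_less_mult_iff)
    finally show "indicator {a<..<t} (a + u * r) *\<^sub>R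
      ((t - (a + u * r)) powr (\<alpha> - 1) * mittag_leffler \<alpha> (- l * (a + u * r - a) powr \<alpha>))
      = indicator {0<..<1} r * ((u - u * r) powr (\<alpha> - 1) * mittag_leffler \<alpha> (- l * (u * r) powr \<alpha>))"
      by (simp only: indicator_def) (simp add: u_def diff_diff_eq)
  qed
  finally show ?thesis
    using integral_mittag_leffler_scaled[OF \<alpha> l u] unfolding RL_int_left_def u_def[symmetric] by simp
qed

lemma RL_int_right_mittag_leffler:
  fixes \<alpha> l :: real
  assumes \<alpha>: "0 < \<alpha>" "\<alpha> < 1" and l: "l \<noteq> 0" and t: "t < b"
  shows "RL_int_right \<alpha> b (\<lambda>x. mittag_leffler \<alpha> (- l * (b - x) powr \<alpha>)) t
    = (1 - mittag_leffler \<alpha> (- l * (b - t) powr \<alpha>)) / l"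
proof -
  define u where "u = b - t"
  have u: "u > 0" using t unfolding u_def by simp
  have "(LINT s:{t<..<b}|lebesgue. (s - t) powr (\<alpha> - 1) * mittag_leffler \<alpha> (- l * (b - s) powr \<alpha>))
     = (\<integral>s. indicator {t<..<b} s *\<^sub>R ((s - t) powr (\<alpha> - 1) * mittag_leffler \<alpha> (- l * (b - s) powr \<alpha>)) \<partial>lborel)"
    unfolding set_lebesgue_integral_def by (subst integral_completion) auto
  also have "\<dots> = u * (\<integral>r. indicator {t<..<b} (b + - u * r) *\<^sub>R
      ((b + - u * r - t) powr (\<alpha> - 1) * mittag_leffler \<alpha> (- l * (b - (b + - u * r)) powr \<alpha>)) \<partial>lborel)"
    using u by (subst lborel_integral_real_affine[where c = "- u" and t = b]) auto
  also have "(\<lambda>r. indicator {t<..<b} (b + - u * r) *\<^sub>R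
      ((b + - u * r - t) powr (\<alpha> - 1) * mittag_leffler \<alpha> (- l * (b - (b + - u * r)) powr \<alpha>)))
    = (\<lambda>r. indicator {0<..<1} r * ((u - u * r) powr (\<alpha> - 1) * mittag_leffler \<alpha> (- l * (u * r) powr \<alpha>)))"
  proof
    fix r
    have "b + - u * r \<in> {t<..<b} \<longleftrightarrow> 0 < u * r \<and> u * r < u"
      by (intro iffI conjI; use u_def in \<open>simp only: greaterThanLessThan_iff, linarith\<close>)
    also have "\<dots> \<longleftrightarrow> r \<in> {0<..<1}"
      using u by (auto simp: zero_less_mult_iff)
    moreover have "b + - u * r - t = u - u * r" "b - (b + - u * r) = u * r"
      by (simp_all add: u_def algebra_simps)
    ultimately show "indicator {t<..<b} (b + - u * r) *\<^sub>R
      ((b + - u * r - t) powr (\<alpha> - 1) * mittag_leffler \<alpha> (- l * (b - (b + - u * r)) powr \<alpha>))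
      = indicator {0<..<1} r * ((u - u * r) powr (\<alpha> - 1) * mittag_leffler \<alpha> (- l * (u * r) powr \<alpha>))"
      by (simp only: indicator_def) simp
  qed
  finally show ?thesis
    using integral_mittag_leffler_scaled[OF \<alpha> l u] unfolding RL_int_right_def u_def[symmetric] by simp
qed

lemma nn_integral_powr_finite_bounded:
  fixes F :: "real \<Rightarrow> real"
  assumes supp: "\<And>x. x \<notin> {a<..<b} \<Longrightarrow> F x = 0" and bound: "\<And>x. \<bar>F x\<bar> \<le> M" and r: "r \<ge> 0"
  shows "(\<integral>\<^sup>+x. ennreal (\<bar>F x\<bar> powr r) \<partial>lborel) < \<infinity>"
proof -
  have "(\<integral>\<^sup>+x. ennreal (\<bar>F x\<bar> powr r) \<partial>lborel) \<le> (\<integral>\<^sup>+x. ennreal (M powr r) * indicator {a<..<b} x \<partial>lborel)"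
    using supp bound r by (intro nn_integral_mono) (auto simp: indicator_def intro!: ennreal_leI powr_mono2)
  also have "\<dots> = ennreal (M powr r) * emeasure lborel {a<..<b}"
    by (simp add: nn_integral_cmult_indicator)
  also have "\<dots> < \<infinity>"
    using emeasure_bounded_finite[of "{a<..<b}"] by (simp add: ennreal_mult_less_top)
  finally show ?thesis .
qed

lemma abs_mittag_leffler_kernel_le:
  fixes l :: real
  assumes \<alpha>: "0 < \<alpha>" "\<alpha> < 1" and "0 \<le> z" "z \<le> c"
  shows "\<bar>mittag_leffler \<alpha> (- l * z powr \<alpha>)\<bar> \<le> mittag_leffler \<alpha> (\<bar>l\<bar> * c powr \<alpha>)"
  using assms by (intro abs_mittag_leffler_le) (auto simp: abs_mult intro!: mult_left_mono powr_mono2)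

section \<open>Convolution with the kernel yields a primitive\<close>

text \<open>With \<kappa> the kernel as a function of \<open>x\<close>, Fubini replaces
  \<open>l\<close> times the left integral of \<psi> against \<kappa> by \<psi> against
  \<open>l\<close> times the right integral of \<kappa>. The latter is
  \<open>1 - \<kappa> x\<close>, so the terms containing \<kappa> cancel.\<close>

lemma mittag_leffler_convolution_left:
  fixes \<psi> :: "real \<Rightarrow> real" and \<alpha> l :: real
  assumes [measurable]: "\<psi> \<in> borel_measurable borel"
    and int: "integrable lborel \<psi>"
    and \<alpha>: "0 < \<alpha>" "\<alpha> < 1" and l: "l \<noteq> 0" and u: "a < u"
  shows "(LINT x:{a<..<u}|lebesgue. (\<psi> x + l * RL_int_left \<alpha> a \<psi> x) * mittag_leffler \<alpha> (- l * (u - x) powr \<alpha>))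
    = (LINT x:{a<..<u}|lborel. \<psi> x)"
proof -
  define \<kappa> where "\<kappa> = (\<lambda>x. mittag_leffler \<alpha> (- l * (u - x) powr \<alpha>))"
  define \<phi> where "\<phi> = (\<lambda>x. indicator {a<..<u} x * \<kappa> x)"
  define \<psi>' where "\<psi>' = (\<lambda>x. indicator {a<..<u} x * \<psi> x)"
  define M where "M = mittag_leffler \<alpha> (\<bar>l\<bar> * (u - a) powr \<alpha>)"
  have [measurable]: "\<kappa> \<in> borel_measurable borel"
    unfolding \<kappa>_def by measurable
  have [measurable]: "\<phi> \<in> borel_measurable borel" "\<psi>' \<in> borel_measurable borel"
    unfolding \<phi>_def \<psi>'_def by measurable
  \<comment> \<open>The instance at 0 gives \<open>M \<ge> 0\<close>, which settles the points
    outside the interval, where \<phi> is 0.\<close>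
  have bound: "\<bar>\<phi> x\<bar> \<le> M" for x
    using abs_mittag_leffler_kernel_le[OF \<alpha>, of "u - x" "u - a" l]
      abs_mittag_leffler_kernel_le[OF \<alpha>, of 0 "u - a" l] u
    unfolding \<phi>_def \<kappa>_def M_def by (cases "x \<in> {a<..<u}") (auto intro: order_trans[OF abs_ge_zero])
  have int\<psi>': "integrable lborel \<psi>'"
    unfolding \<psi>'_def using int integrable_real_mult_indicator[of "{a<..<u}" lborel \<psi>] by (simp add: mult.commute)
  \<comment> \<open>The pair of exponents \<open>2 / \<alpha>\<close>, 1 is admissible: \<open>\<alpha> / 2 + 1 < 1 + \<alpha>\<close>.\<close>
  have fin\<phi>: "(\<integral>\<^sup>+x. ennreal (\<bar>\<phi> x\<bar> powr (2 / \<alpha>)) \<partial>lborel) < \<infinity>"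
    using \<alpha> bound by (intro nn_integral_powr_finite_bounded[of a u]) (auto simp: \<phi>_def)
  have fin\<psi>: "(\<integral>\<^sup>+x. ennreal (\<bar>\<psi>' x\<bar> powr 1) \<partial>lborel) < \<infinity>"
    using int\<psi>' by (simp add: integrable_iff_bounded)
  have fin: "(\<integral>\<^sup>+x. \<integral>\<^sup>+y. ennreal (\<bar>\<phi> x\<bar> * \<bar>\<psi>' y\<bar> * \<bar>x - y\<bar> powr (\<alpha> - 1)) \<partial>lborel \<partial>lborel) < \<infinity>"
    using \<alpha> by (intro fractional_kernel_finite[OF _ _ _ _ fin\<phi> fin\<psi>, of a u]) (auto simp: \<phi>_def \<psi>'_def)
  note parts = integrable_mult_RL_int_left[OF _ _ _ _ \<alpha>(1) fin, of a u]
    integral_RL_int_by_parts[OF _ _ _ _ \<alpha>(1) fin, of a u]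
  \<comment> \<open>The left integral at \<open>x\<close> sees only values to the left of
    \<open>x\<close>, so cutting \<psi> off at \<open>u > x\<close> changes nothing.\<close>
  have left: "RL_int_left \<alpha> a \<psi>' x = RL_int_left \<alpha> a \<psi> x" if "x \<in> {a<..<u}" for x
    unfolding RL_int_left_def using that
    by (intro arg_cong2[where f = "(*)"] set_lebesgue_integral_cong) (auto simp: \<psi>'_def)
  have right: "RL_int_right \<alpha> u \<phi> x = (1 - \<kappa> x) / l" if "x \<in> {a<..<u}" for x
  proof -
    have "RL_int_right \<alpha> u \<phi> x = RL_int_right \<alpha> u \<kappa> x"
      unfolding RL_int_right_def using that
      by (intro arg_cong2[where f = "(*)"] set_lebesgue_integral_cong) (auto simp: \<phi>_def)
    then show ?thesis
      using RL_int_right_mittag_leffler[OF \<alpha> l, of x u] that unfolding \<kappa>_def by simp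
  qed
  have int\<kappa>: "integrable lborel (\<lambda>x. \<phi> x * \<psi>' x)"
  proof (rule Bochner_Integration.integrable_bound[OF integrable_mult_right[of M lborel \<psi>']])
    show "AE x in lborel. norm (\<phi> x * \<psi>' x) \<le> norm (M * \<psi>' x)"
      using bound by (intro AE_I2) (simp add: abs_mult mult_right_mono order_trans[OF _ abs_ge_self])
  qed (use int\<psi>' in auto)
  have app: "\<psi>' x = indicator {a<..<u} x * \<psi> x" "\<phi> x = indicator {a<..<u} x * \<kappa> x" for x
    unfolding \<psi>'_def \<phi>_def by auto
  have I: "integrable lborel (\<lambda>x. \<phi> x * RL_int_left \<alpha> a \<psi>' x)"
    by (rule parts(1)) (auto simp: \<phi>_def \<psi>'_def)
  have E: "(\<integral>x. \<phi> x * RL_int_left \<alpha> a \<psi>' x \<partial>lborel) = (\<integral>x. RL_int_right \<alpha> u \<phi> x * \<psi>' x \<partial>lborel)"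
    by (rule parts(2)) (auto simp: \<phi>_def \<psi>'_def)
  have "(LINT x:{a<..<u}|lebesgue. (\<psi> x + l * RL_int_left \<alpha> a \<psi> x) * \<kappa> x)
      = (\<integral>x. \<phi> x * \<psi>' x + l * (\<phi> x * RL_int_left \<alpha> a \<psi>' x) \<partial>lebesgue)"
    unfolding set_lebesgue_integral_def
    by (intro Bochner_Integration.integral_cong)
       (simp_all add: app left indicator_def algebra_simps)
  also have "\<dots> = (\<integral>x. \<phi> x * \<psi>' x + l * (\<phi> x * RL_int_left \<alpha> a \<psi>' x) \<partial>lborel)"
    using int\<kappa> I by (intro integral_completion) auto
  also have "\<dots> = (\<integral>x. \<phi> x * \<psi>' x \<partial>lborel) + l * (\<integral>x. RL_int_right \<alpha> u \<phi> x * \<psi>' x \<partial>lborel)"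
    using int\<kappa> I by (simp add: E)
  also have "(\<integral>x. RL_int_right \<alpha> u \<phi> x * \<psi>' x \<partial>lborel) = (\<integral>x. (\<psi>' x - \<phi> x * \<psi>' x) / l \<partial>lborel)"
  proof (intro Bochner_Integration.integral_cong refl)
    fix x
    show "RL_int_right \<alpha> u \<phi> x * \<psi>' x = (\<psi>' x - \<phi> x * \<psi>' x) / l"
      by (cases "x \<in> {a<..<u}") (simp_all add: app right algebra_simps diff_divide_distrib)
  qed
  also have "\<dots> = ((\<integral>x. \<psi>' x \<partial>lborel) - (\<integral>x. \<phi> x * \<psi>' x \<partial>lborel)) / l"
    using int\<kappa> int\<psi>' by simp
  also have "(\<integral>x. \<phi> x * \<psi>' x \<partial>lborel) + l * (((\<integral>x. \<psi>' x \<partial>lborel) - (\<integral>x. \<phi> x * \<psi>' x \<partial>lborel)) / l)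
      = (LINT x:{a<..<u}|lborel. \<psi> x)"
    using l unfolding \<psi>'_def set_lebesgue_integral_def by simp
  finally show ?thesis unfolding \<kappa>_def .
qed

text \<open>The mirror image: the truncated kernel now stands in the second slot of the integration
  by parts, and it is the left integral from \<open>u\<close> that produces
  \<open>1 - \<kappa> x\<close>.\<close>

lemma mittag_leffler_convolution_right:
  fixes \<phi> :: "real \<Rightarrow> real" and \<alpha> l :: real
  assumes [measurable]: "\<phi> \<in> borel_measurable borel"
    and int: "integrable lborel \<phi>"
    and \<alpha>: "0 < \<alpha>" "\<alpha> < 1" and l: "l \<noteq> 0" and u: "u < b"
  shows "(LINT x:{u<..<b}|lebesgue. (\<phi> x + l * RL_int_right \<alpha> b \<phi> x) * mittag_leffler \<alpha> (- l * (x - u) powr \<alpha>))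
    = (LINT x:{u<..<b}|lborel. \<phi> x)"
proof -
  define \<kappa> where "\<kappa> = (\<lambda>x. mittag_leffler \<alpha> (- l * (x - u) powr \<alpha>))"
  define \<psi> where "\<psi> = (\<lambda>x. indicator {u<..<b} x * \<kappa> x)"
  define \<phi>' where "\<phi>' = (\<lambda>x. indicator {u<..<b} x * \<phi> x)"
  define M where "M = mittag_leffler \<alpha> (\<bar>l\<bar> * (b - u) powr \<alpha>)"
  have [measurable]: "\<kappa> \<in> borel_measurable borel"
    unfolding \<kappa>_def by measurable
  have [measurable]: "\<psi> \<in> borel_measurable borel" "\<phi>' \<in> borel_measurable borel"
    unfolding \<psi>_def \<phi>'_def by measurable
  have bound: "\<bar>\<psi> x\<bar> \<le> M" for x
    using abs_mittag_leffler_kernel_le[OF \<alpha>, of "x - u" "b - u" l]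
      abs_mittag_leffler_kernel_le[OF \<alpha>, of 0 "b - u" l] u
    unfolding \<psi>_def \<kappa>_def M_def by (cases "x \<in> {u<..<b}") (auto intro: order_trans[OF abs_ge_zero])
  have int\<phi>': "integrable lborel \<phi>'"
    unfolding \<phi>'_def using int integrable_real_mult_indicator[of "{u<..<b}" lborel \<phi>] by (simp add: mult.commute)
  have fin\<psi>: "(\<integral>\<^sup>+x. ennreal (\<bar>\<psi> x\<bar> powr (2 / \<alpha>)) \<partial>lborel) < \<infinity>"
    using \<alpha> bound by (intro nn_integral_powr_finite_bounded[of u b]) (auto simp: \<psi>_def)
  have fin\<phi>: "(\<integral>\<^sup>+x. ennreal (\<bar>\<phi>' x\<bar> powr 1) \<partial>lborel) < \<infinity>"
    using int\<phi>' by (simp add: integrable_iff_bounded)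
  have fin: "(\<integral>\<^sup>+x. \<integral>\<^sup>+y. ennreal (\<bar>\<phi>' x\<bar> * \<bar>\<psi> y\<bar> * \<bar>x - y\<bar> powr (\<alpha> - 1)) \<partial>lborel \<partial>lborel) < \<infinity>"
    using \<alpha> by (intro fractional_kernel_finite[OF _ _ _ _ fin\<phi> fin\<psi>, of u b]) (auto simp: \<psi>_def \<phi>'_def)
  note parts = integrable_RL_int_right_mult[OF _ _ _ _ \<alpha>(1) fin, of u b]
    integral_RL_int_by_parts[OF _ _ _ _ \<alpha>(1) fin, of u b]
  have right: "RL_int_right \<alpha> b \<phi>' x = RL_int_right \<alpha> b \<phi> x" if "x \<in> {u<..<b}" for x
    unfolding RL_int_right_def using that
    by (intro arg_cong2[where f = "(*)"] set_lebesgue_integral_cong) (auto simp: \<phi>'_def)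
  have left: "RL_int_left \<alpha> u \<psi> x = (1 - \<kappa> x) / l" if "x \<in> {u<..<b}" for x
  proof -
    have "RL_int_left \<alpha> u \<psi> x = RL_int_left \<alpha> u \<kappa> x"
      unfolding RL_int_left_def using that
      by (intro arg_cong2[where f = "(*)"] set_lebesgue_integral_cong) (auto simp: \<psi>_def)
    then show ?thesis
      using RL_int_left_mittag_leffler[OF \<alpha> l, of u x] that unfolding \<kappa>_def by simp
  qed
  have int\<kappa>: "integrable lborel (\<lambda>x. \<psi> x * \<phi>' x)"
  proof (rule Bochner_Integration.integrable_bound[OF integrable_mult_right[of M lborel \<phi>']])
    show "AE x in lborel. norm (\<psi> x * \<phi>' x) \<le> norm (M * \<phi>' x)"
      using bound by (intro AE_I2) (simp add: abs_mult mult_right_mono order_trans[OF _ abs_ge_self])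
  qed (use int\<phi>' in auto)
  have app: "\<phi>' x = indicator {u<..<b} x * \<phi> x" "\<psi> x = indicator {u<..<b} x * \<kappa> x" for x
    unfolding \<phi>'_def \<psi>_def by auto
  have I: "integrable lborel (\<lambda>x. RL_int_right \<alpha> b \<phi>' x * \<psi> x)"
    by (rule parts(1)) (auto simp: \<psi>_def \<phi>'_def)
  have E: "(\<integral>x. RL_int_right \<alpha> b \<phi>' x * \<psi> x \<partial>lborel) = (\<integral>x. \<phi>' x * RL_int_left \<alpha> u \<psi> x \<partial>lborel)"
    by (rule parts(2)[symmetric]) (auto simp: \<psi>_def \<phi>'_def)
  have "(LINT x:{u<..<b}|lebesgue. (\<phi> x + l * RL_int_right \<alpha> b \<phi> x) * \<kappa> x)
      = (\<integral>x. \<psi> x * \<phi>' x + l * (RL_int_right \<alpha> b \<phi>' x * \<psi> x) \<partial>lebesgue)"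
    unfolding set_lebesgue_integral_def
    by (intro Bochner_Integration.integral_cong)
       (simp_all add: app right indicator_def algebra_simps)
  also have "\<dots> = (\<integral>x. \<psi> x * \<phi>' x + l * (RL_int_right \<alpha> b \<phi>' x * \<psi> x) \<partial>lborel)"
    using int\<kappa> I by (intro integral_completion) auto
  also have "\<dots> = (\<integral>x. \<psi> x * \<phi>' x \<partial>lborel) + l * (\<integral>x. \<phi>' x * RL_int_left \<alpha> u \<psi> x \<partial>lborel)"
    using int\<kappa> I by (simp add: E)
  also have "(\<integral>x. \<phi>' x * RL_int_left \<alpha> u \<psi> x \<partial>lborel) = (\<integral>x. (\<phi>' x - \<psi> x * \<phi>' x) / l \<partial>lborel)"
  proof (intro Bochner_Integration.integral_cong refl)
    fix x
    show "\<phi>' x * RL_int_left \<alpha> u \<psi> x = (\<phi>' x - \<psi> x * \<phi>' x) / l"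
      by (cases "x \<in> {u<..<b}") (simp_all add: app left algebra_simps diff_divide_distrib)
  qed
  also have "\<dots> = ((\<integral>x. \<phi>' x \<partial>lborel) - (\<integral>x. \<psi> x * \<phi>' x \<partial>lborel)) / l"
    using int\<kappa> int\<phi>' by simp
  also have "(\<integral>x. \<psi> x * \<phi>' x \<partial>lborel) + l * (((\<integral>x. \<phi>' x \<partial>lborel) - (\<integral>x. \<psi> x * \<phi>' x \<partial>lborel)) / l)
      = (LINT x:{u<..<b}|lborel. \<phi> x)"
    using l unfolding \<phi>'_def set_lebesgue_integral_def by simp
  finally show ?thesis unfolding \<kappa>_def .
qed

section \<open>Differentiation of primitives almost everywhere\<close>

text \<open>\<open>integrable_ccontinuous_explicit\<close> controls averages over intervals to the
  right of a point. Applied to the reflection of \<open>f\<close> it also controls those to the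
  left, which gives a two-sided derivative off \<open>N1\<close> and the reflected
  \<open>N2\<close>. The set \<open>N\<close> does not depend on the base point
  \<open>a\<close>.\<close>

lemma Lebesgue_differentiation:
  fixes f :: "real \<Rightarrow> real"
  assumes int: "integrable lborel f"
  obtains N where "negligible N"
    "\<And>a t. \<lbrakk>t \<notin> N; a < t\<rbrakk> \<Longrightarrow> ((\<lambda>u. integral {a..u} f) has_real_derivative f t) (at t)"
proof -
  have i: "f integrable_on {c..d}" for c d
    using integrable_on_lborel[OF int] by (rule integrable_on_subinterval) auto
  have i': "(\<lambda>x. f (- x)) integrable_on {c..d}" for c d
    using i[of "- d" "- c"] Henstock_Kurzweil_Integration.integrable_reflect_real[where f = f and a = "- d" and b = "- c"] by simp
  obtain N1 where N1: "negligible N1" "\<And>x e. \<lbrakk>x \<notin> N1; 0 < e\<rbrakk> \<Longrightarrow>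
     \<exists>d>0. \<forall>h. 0 < h \<and> h < d \<longrightarrow> norm (integral {x..x + h} f / h - f x) < e"
    using integrable_ccontinuous_explicit[of f] i by (auto simp: divide_inverse_commute)
  obtain N2 where N2: "negligible N2" "\<And>x e. \<lbrakk>x \<notin> N2; 0 < e\<rbrakk> \<Longrightarrow>
     \<exists>d>0. \<forall>h. 0 < h \<and> h < d \<longrightarrow> norm (integral {x..x + h} (\<lambda>x. f (- x)) / h - f (- x)) < e"
    using integrable_ccontinuous_explicit[of "\<lambda>x. f (- x)"] i' by (auto simp: divide_inverse_commute)
  define N where "N = N1 \<union> uminus ` N2"
  have "negligible N"
    unfolding N_def using N1(1) N2(1)
    by (intro negligible_Un negligible_differentiable_image_negligible) (auto intro!: derivative_intros)
  moreover have "((\<lambda>u. integral {a..u} f) has_real_derivative f t) (at t)" if t: "t \<notin> N" "a < t" for a t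
    unfolding DERIV_def LIM_eq
  proof (intro allI impI)
    fix e :: real assume e: "e > 0"
    have "t \<notin> N1" "- t \<notin> N2"
      using t unfolding N_def by (auto simp: image_iff)
    obtain d1 where d1: "d1 > 0" "\<And>h. 0 < h \<Longrightarrow> h < d1 \<Longrightarrow> norm (integral {t..t + h} f / h - f t) < e"
      using N1(2)[OF \<open>t \<notin> N1\<close> e] by blast
    obtain d2 where d2: "d2 > 0" "\<And>h. 0 < h \<Longrightarrow> h < d2 \<Longrightarrow>
        norm (integral {- t..- t + h} (\<lambda>x. f (- x)) / h - f (- (- t))) < e"
      using N2(2)[OF \<open>- t \<notin> N2\<close> e] by blast
    \<comment> \<open>The bound \<open>t - a\<close> on the increment keeps \<open>t + h\<close> to
      the right of \<open>a\<close>, so that the integrals can be combined.\<close>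
    have "norm ((integral {a..t + h} f - integral {a..t} f) / h - f t) < e"
      if h: "h \<noteq> 0" "\<bar>h\<bar> < min (t - a) (min d1 d2)" for h
    proof (cases "h > 0")
      case True
      have "integral {a..t} f + integral {t..t + h} f = integral {a..t + h} f"
        using True t by (intro Henstock_Kurzweil_Integration.integral_combine i) auto
      then have "integral {a..t + h} f - integral {a..t} f = integral {t..t + h} f" by simp
      then show ?thesis using d1(2)[of h] True h by simp
    next
      case False
      have "integral {a..t + h} f + integral {t + h..t} f = integral {a..t} f"
        using False t h by (intro Henstock_Kurzweil_Integration.integral_combine i) auto
      moreover have "integral {- t..- t + (- h)} (\<lambda>x. f (- x)) = integral {t + h..t} f"
        using Henstock_Kurzweil_Integration.integral_reflect_real[where f = f and a = "t + h" and b = t] by (simp add: add.commute)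
      ultimately have "(integral {a..t + h} f - integral {a..t} f) / h
          = integral {- t..- t + (- h)} (\<lambda>x. f (- x)) / (- h)"
        by (simp add: divide_simps)
      then show ?thesis using d2(2)[of "- h"] False h by simp
    qed
    moreover have "min (t - a) (min d1 d2) > 0" using t d1(1) d2(1) by simp
    ultimately show "\<exists>s>0. \<forall>h. h \<noteq> 0 \<and> norm (h - 0) < s \<longrightarrow>
        norm ((integral {a..t + h} f - integral {a..t} f) / h - f t) < e"
      by (intro exI[of _ "min (t - a) (min d1 d2)"]) auto
  qed
  ultimately show ?thesis using that by blast
qed

subsection \<open>Functions in $L_p$\<close>

text \<open>Measurability passes across equality almost everywhere because \<open>lebesgue\<close>
  is complete, so neither function has to be known measurable. If one is not integrable, neither is
  the other, and both integrals are 0.\<close>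

lemma
  fixes f g :: "real \<Rightarrow> real"
  assumes "AE x in lebesgue. x \<in> A \<longrightarrow> f x = g x"
  shows set_integrable_lebesgue_cong_AE: "set_integrable lebesgue A f \<longleftrightarrow> set_integrable lebesgue A g"
    and set_integral_lebesgue_cong_AE: "(LINT x:A|lebesgue. f x) = (LINT x:A|lebesgue. g x)"
proof -
  let ?f = "\<lambda>x. indicator A x *\<^sub>R f x" and ?g = "\<lambda>x. indicator A x *\<^sub>R g x"
  have ae: "AE x in lebesgue. ?f x = ?g x"
    using assms by eventually_elim (auto simp: indicator_def)
  then have ae': "AE x in lebesgue. ?g x = ?f x"
    by eventually_elim (rule sym)
  have meas: "?f \<in> borel_measurable lebesgue \<longleftrightarrow> ?g \<in> borel_measurable lebesgue"
    using borel_measurable_AE[OF _ ae] borel_measurable_AE[OF _ ae'] by blast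
  have int: "integrable lebesgue ?f \<longleftrightarrow> integrable lebesgue ?g"
    using meas ae integrable_cong_AE[of ?f lebesgue ?g] borel_measurable_integrable by blast
  then show "set_integrable lebesgue A f \<longleftrightarrow> set_integrable lebesgue A g"
    unfolding set_integrable_def .
  show "(LINT x:A|lebesgue. f x) = (LINT x:A|lebesgue. g x)"
    unfolding set_lebesgue_integral_def
  proof (cases "integrable lebesgue ?f")
    case True
    then show "integral\<^sup>L lebesgue ?f = integral\<^sup>L lebesgue ?g"
      using int ae by (intro integral_cong_AE) auto
  next
    case False
    then show "integral\<^sup>L lebesgue ?f = integral\<^sup>L lebesgue ?g"
      using int by (simp add: not_integrable_integral_eq)
  qed
qed

text \<open>Fubini is applied on the product of two copies of \<open>lborel\<close>, which calls for
  Borel functions, whereas members of \<open>Lp_space\<close> are only Lebesgue measurable.\<close>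

lemma Lp_space_borel_representative:
  assumes "\<phi> \<in> Lp_space p a b"
  obtains \<phi>' where "\<phi>' \<in> borel_measurable borel" "\<And>x. x \<notin> {a<..<b} \<Longrightarrow> \<phi>' x = 0"
    "AE x in lebesgue. x \<in> {a<..<b} \<longrightarrow> \<phi> x = \<phi>' x"
    "(\<integral>\<^sup>+x. ennreal (\<bar>\<phi>' x\<bar> powr p) \<partial>lborel) < \<infinity>"
proof -
  have "(\<lambda>x. indicator {a<..<b} x *\<^sub>R \<phi> x) \<in> borel_measurable lebesgue"
    using assms unfolding Lp_space_def set_borel_measurable_def by simp
  then obtain g where g: "g \<in> borel_measurable lborel" "AE x in lborel. indicator {a<..<b} x *\<^sub>R \<phi> x = g x"
    by (metis completion_ex_borel_measurable_real)
  define \<phi>' where "\<phi>' = (\<lambda>x. indicator {a<..<b} x * g x)"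
  have [measurable]: "\<phi>' \<in> borel_measurable borel"
    using g(1) unfolding \<phi>'_def by measurable
  have ae: "AE x in lebesgue. x \<in> {a<..<b} \<longrightarrow> \<phi> x = \<phi>' x"
    using AE_completion[OF g(2)] by eventually_elim (auto simp: \<phi>'_def)
  then have "AE x in lebesgue. x \<in> {a<..<b} \<longrightarrow> \<bar>\<phi> x\<bar> powr p = \<bar>\<phi>' x\<bar> powr p"
    by eventually_elim simp
  then have "set_integrable lebesgue {a<..<b} (\<lambda>x. \<bar>\<phi>' x\<bar> powr p)"
    using assms unfolding Lp_space_def by (simp add: set_integrable_lebesgue_cong_AE)
  moreover have "(\<lambda>x. indicator {a<..<b} x *\<^sub>R \<bar>\<phi>' x\<bar> powr p) = (\<lambda>x. \<bar>\<phi>' x\<bar> powr p)"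
    by (auto simp: \<phi>'_def indicator_def)
  ultimately have "integrable lborel (\<lambda>x. \<bar>\<phi>' x\<bar> powr p)"
    unfolding set_integrable_def by (simp add: integrable_completion)
  then have "(\<integral>\<^sup>+x. ennreal (\<bar>\<phi>' x\<bar> powr p) \<partial>lborel) < \<infinity>"
    by (simp add: integrable_iff_bounded)
  moreover have "\<phi>' x = 0" if "x \<notin> {a<..<b}" for x
    using that unfolding \<phi>'_def by auto
  ultimately show ?thesis
    using ae by (intro that[of \<phi>']) auto
qed

text \<open>A null set is invisible to the integral, so the equality holds at every
  \<open>t \<le> b\<close> and not just at almost every one.\<close>

lemma RL_int_left_cong_AE:
  assumes "AE x in lebesgue. x \<in> {a<..<b} \<longrightarrow> \<phi> x = \<phi>' x" "t \<le> b"
  shows "RL_int_left \<alpha> a \<phi> t = RL_int_left \<alpha> a \<phi>' t"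
proof -
  have "AE x in lebesgue. x \<in> {a<..<t} \<longrightarrow> (t - x) powr (\<alpha> - 1) * \<phi> x = (t - x) powr (\<alpha> - 1) * \<phi>' x"
    using assms(1) by eventually_elim (use assms(2) in auto)
  then show ?thesis
    unfolding RL_int_left_def by (simp add: set_integral_lebesgue_cong_AE)
qed

lemma RL_int_right_cong_AE:
  assumes "AE x in lebesgue. x \<in> {a<..<b} \<longrightarrow> \<phi> x = \<phi>' x" "a \<le> t"
  shows "RL_int_right \<alpha> b \<phi> t = RL_int_right \<alpha> b \<phi>' t"
proof -
  have "AE x in lebesgue. x \<in> {t<..<b} \<longrightarrow> (x - t) powr (\<alpha> - 1) * \<phi> x = (x - t) powr (\<alpha> - 1) * \<phi>' x"
    using assms(1) by eventually_elim (use assms(2) in auto)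
  then show ?thesis
    unfolding RL_int_right_def by (simp add: set_integral_lebesgue_cong_AE)
qed

text \<open>These products are integrable on the whole range of exponents, even where \<psi>\<phi>
  is not.\<close>

lemma
  fixes a b \<alpha> p q :: real
  assumes \<alpha>: "0 < \<alpha>" "\<alpha> < 1" and pq: "p \<ge> 1" "q \<ge> 1" "1 / p + 1 / q \<le> 1 + \<alpha>"
      "1 / p + 1 / q = 1 + \<alpha> \<Longrightarrow> p \<noteq> 1 \<and> q \<noteq> 1"
    and \<phi>: "\<phi> \<in> Lp_space p a b" and \<psi>: "\<psi> \<in> Lp_space q a b"
  shows set_integrable_mult_RL_int_left_Lp:
      "set_integrable lebesgue {a<..<b} (\<lambda>x. \<phi> x * RL_int_left \<alpha> a \<psi> x)" (is ?L)
    and set_integrable_RL_int_right_mult_Lp: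
      "set_integrable lebesgue {a<..<b} (\<lambda>x. RL_int_right \<alpha> b \<phi> x * \<psi> x)" (is ?R)
    and RL_int_by_parts_Lp:
      "(LINT x:{a<..<b}|lebesgue. \<phi> x * RL_int_left \<alpha> a \<psi> x)
        = (LINT x:{a<..<b}|lebesgue. RL_int_right \<alpha> b \<phi> x * \<psi> x)" (is ?E)
proof -
  obtain \<phi>' where \<phi>': "\<phi>' \<in> borel_measurable borel" "\<And>x. x \<notin> {a<..<b} \<Longrightarrow> \<phi>' x = 0"
    "AE x in lebesgue. x \<in> {a<..<b} \<longrightarrow> \<phi> x = \<phi>' x"
    "(\<integral>\<^sup>+x. ennreal (\<bar>\<phi>' x\<bar> powr p) \<partial>lborel) < \<infinity>"
    using Lp_space_borel_representative[OF \<phi>] by blast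
  obtain \<psi>' where \<psi>': "\<psi>' \<in> borel_measurable borel" "\<And>x. x \<notin> {a<..<b} \<Longrightarrow> \<psi>' x = 0"
    "AE x in lebesgue. x \<in> {a<..<b} \<longrightarrow> \<psi> x = \<psi>' x"
    "(\<integral>\<^sup>+x. ennreal (\<bar>\<psi>' x\<bar> powr q) \<partial>lborel) < \<infinity>"
    using Lp_space_borel_representative[OF \<psi>] by blast
  note fin = fractional_kernel_finite[OF \<phi>'(1) \<psi>'(1) \<phi>'(2) \<psi>'(2) \<phi>'(4) \<psi>'(4) \<alpha> pq]
  note parts = integrable_mult_RL_int_left[OF \<phi>'(1) \<psi>'(1) \<phi>'(2) \<psi>'(2) \<alpha>(1) fin]
    integrable_RL_int_right_mult[OF \<phi>'(1) \<psi>'(1) \<phi>'(2) \<psi>'(2) \<alpha>(1) fin]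
    integral_RL_int_by_parts[OF \<phi>'(1) \<psi>'(1) \<phi>'(2) \<psi>'(2) \<alpha>(1) fin]
  have l: "AE x in lebesgue. x \<in> {a<..<b} \<longrightarrow> \<phi> x * RL_int_left \<alpha> a \<psi> x = \<phi>' x * RL_int_left \<alpha> a \<psi>' x"
    using \<phi>'(3) by eventually_elim (auto simp: RL_int_left_cong_AE[OF \<psi>'(3)])
  have r: "AE x in lebesgue. x \<in> {a<..<b} \<longrightarrow> RL_int_right \<alpha> b \<phi> x * \<psi> x = RL_int_right \<alpha> b \<phi>' x * \<psi>' x"
    using \<psi>'(3) by eventually_elim (auto simp: RL_int_right_cong_AE[OF \<phi>'(3)])
  have il: "(\<lambda>x. indicator {a<..<b} x *\<^sub>R (\<phi>' x * RL_int_left \<alpha> a \<psi>' x)) = (\<lambda>x. \<phi>' x * RL_int_left \<alpha> a \<psi>' x)"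
    and ir: "(\<lambda>x. indicator {a<..<b} x *\<^sub>R (RL_int_right \<alpha> b \<phi>' x * \<psi>' x)) = (\<lambda>x. RL_int_right \<alpha> b \<phi>' x * \<psi>' x)"
    using \<phi>'(2) \<psi>'(2) by (auto simp: indicator_def fun_eq_iff)
  show ?L
    unfolding set_integrable_lebesgue_cong_AE[OF l]
    using parts(1) unfolding set_integrable_def il by (subst integrable_completion) auto
  show ?R
    unfolding set_integrable_lebesgue_cong_AE[OF r]
    using parts(2) unfolding set_integrable_def ir by (subst integrable_completion) auto
  show ?E
    unfolding set_integral_lebesgue_cong_AE[OF l] set_integral_lebesgue_cong_AE[OF r]
    using parts unfolding set_lebesgue_integral_def il ir
    by (simp add: integral_completion borel_measurable_integrable)
qed

text \<open>The exponents need not be conjugate; boundedness of the interval makes up for that,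
  through the constant 1 in the majorant.\<close>

lemma set_integrable_mult_Lp:
  assumes pq: "p \<ge> 1" "q \<ge> 1" "1 / p + 1 / q \<le> 1"
    and \<phi>: "\<phi> \<in> Lp_space p a b" and \<psi>: "\<psi> \<in> Lp_space q a b"
  shows "set_integrable lebesgue {a<..<b} (\<lambda>x. \<psi> x * \<phi> x)"
proof -
  have pw: "\<bar>v * u\<bar> \<le> 1 + \<bar>u\<bar> powr p + \<bar>v\<bar> powr q" for u v :: real
  proof -
    \<comment> \<open>The factors are at most \<open>m powr (1 / p)\<close> and
      \<open>m powr (1 / q)\<close>. Including 1 in the maximum lets the total exponent, at most 1,
      be raised to 1.\<close>
    define m where "m = max 1 (max (\<bar>u\<bar> powr p) (\<bar>v\<bar> powr q))"
    have "\<bar>u\<bar> = (\<bar>u\<bar> powr p) powr (1 / p)" "\<bar>v\<bar> = (\<bar>v\<bar> powr q) powr (1 / q)"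
      using pq by (simp_all add: powr_powr)
    moreover have "(\<bar>u\<bar> powr p) powr (1 / p) \<le> m powr (1 / p)" "(\<bar>v\<bar> powr q) powr (1 / q) \<le> m powr (1 / q)"
      using pq unfolding m_def by (intro powr_mono2; simp)+
    ultimately have "\<bar>v\<bar> * \<bar>u\<bar> \<le> m powr (1 / q) * m powr (1 / p)"
      by (intro mult_mono) auto
    also have "\<dots> = m powr (1 / p + 1 / q)"
      by (simp add: powr_add mult.commute)
    also have "\<dots> \<le> m powr 1"
      using pq(3) unfolding m_def by (intro powr_mono) auto
    also have "\<dots> \<le> 1 + \<bar>u\<bar> powr p + \<bar>v\<bar> powr q"
      unfolding m_def by auto
    finally show ?thesis by (simp add: abs_mult)
  qed
  let ?i = "indicator {a<..<b} :: real \<Rightarrow> real"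
  have m\<phi>: "(\<lambda>x. ?i x *\<^sub>R \<phi> x) \<in> borel_measurable lebesgue" and m\<psi>: "(\<lambda>x. ?i x *\<^sub>R \<psi> x) \<in> borel_measurable lebesgue"
    using \<phi> \<psi> unfolding Lp_space_def set_borel_measurable_def by auto
  have "(\<lambda>x. (?i x *\<^sub>R \<psi> x) * (?i x *\<^sub>R \<phi> x)) \<in> borel_measurable lebesgue"
    using m\<phi> m\<psi> by (rule borel_measurable_times[rotated])
  moreover have "(\<lambda>x. (?i x *\<^sub>R \<psi> x) * (?i x *\<^sub>R \<phi> x)) = (\<lambda>x. ?i x *\<^sub>R (\<psi> x * \<phi> x))"
    by (auto simp: indicator_def)
  ultimately have "set_borel_measurable lebesgue {a<..<b} (\<lambda>x. \<psi> x * \<phi> x)"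
    unfolding set_borel_measurable_def by simp
  moreover have "set_integrable lebesgue {a<..<b} (\<lambda>x. 1 + \<bar>\<phi> x\<bar> powr p + \<bar>\<psi> x\<bar> powr q)"
  proof (intro set_integral_add)
    show "set_integrable lebesgue {a<..<b} (\<lambda>x. 1::real)"
      unfolding set_integrable_def by (cases "a \<le> b") (auto intro!: integrable_real_indicator)
  qed (use \<phi> \<psi> in \<open>auto simp: Lp_space_def\<close>)
  ultimately show ?thesis
    using pw by (elim set_integrable_bound[rotated]) (auto intro: order_trans[OF _ abs_ge_self])
qed


lemma integrable_of_powr_finite:
  fixes F :: "real \<Rightarrow> real"
  assumes [measurable]: "F \<in> borel_measurable borel"
    and "\<And>x. x \<notin> {a<..<b} \<Longrightarrow> F x = 0"
    and "(\<integral>\<^sup>+x. ennreal (\<bar>F x\<bar> powr p) \<partial>lborel) < \<infinity>" and "p \<ge> 1"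
  shows "integrable lborel F"
  using nn_integral_powr_finite_mono[of F a b p 1] assms by (simp add: integrable_iff_bounded)

lemma set_integral_Ioo_eq_integral:
  fixes f :: "real \<Rightarrow> real"
  assumes "integrable lborel f"
  shows "(LINT x:{c<..<d}|lborel. f x) = integral {c..d} f"
proof -
  have "set_integrable lborel {c<..<d} f"
    using assms unfolding set_integrable_def by (intro integrable_mult_indicator) auto
  then show ?thesis
    by (simp add: set_borel_integral_eq_integral integral_open_interval_real)
qed

section \<open>The ABR derivatives invert the AB integrals\<close>

lemma ABR_deriv_left_AB_int_left:
  assumes \<alpha>: "0 < \<alpha>" "\<alpha> < 1" and B: "B \<alpha> > 0" and q: "q \<ge> 1"
    and \<psi>: "\<psi> \<in> Lp_space q a b"
    and g: "AE x in lebesgue. x \<in> {a<..<b} \<longrightarrow> g x = AB_int_left B \<alpha> a \<psi> x"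
  shows "AE t in lebesgue. t \<in> {a<..<b} \<longrightarrow> ABR_deriv_left B \<alpha> a g t = \<psi> t"
proof -
  obtain \<psi>' where \<psi>': "\<psi>' \<in> borel_measurable borel" "\<And>x. x \<notin> {a<..<b} \<Longrightarrow> \<psi>' x = 0"
    "AE x in lebesgue. x \<in> {a<..<b} \<longrightarrow> \<psi> x = \<psi>' x"
    "(\<integral>\<^sup>+x. ennreal (\<bar>\<psi>' x\<bar> powr q) \<partial>lborel) < \<infinity>"
    using Lp_space_borel_representative[OF \<psi>] by blast
  have int: "integrable lborel \<psi>'"
    using integrable_of_powr_finite[OF \<psi>'(1,2,4) q] .
  obtain N where N: "negligible N"
    "\<And>a t. \<lbrakk>t \<notin> N; a < t\<rbrakk> \<Longrightarrow> ((\<lambda>u. integral {a..u} \<psi>') has_real_derivative \<psi>' t) (at t)"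
    using Lebesgue_differentiation[OF int] by blast
  \<comment> \<open>This constant plays two roles: it is the one in the kernel, and it is what
    remains in front of the fractional integral when \<open>(1 - \<alpha>) / B \<alpha>\<close> is
    factored out of the AB integral.\<close>
  define l where "l = \<alpha> / (1 - \<alpha>)"
  have l: "l \<noteq> 0" using \<alpha> unfolding l_def by simp
  define H where "H = (\<lambda>u. LINT x:{a<..<u}|lebesgue.
      g x * mittag_leffler \<alpha> (- \<alpha> * ((u - x) powr \<alpha> / (1 - \<alpha>))))"
  \<comment> \<open>The identity is needed at every \<open>u\<close> of the open interval:
    differentiating \<open>H\<close> at a single \<open>t\<close> involves a whole neighbourhood.
    Exceptional points arise only from the differentiation itself.\<close>
  have H: "H u = (1 - \<alpha>) / B \<alpha> * integral {a..u} \<psi>'" if u: "u \<in> {a<..<b}" for u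
  proof -
    have ae: "AE x in lebesgue. x \<in> {a<..<u} \<longrightarrow>
        g x * mittag_leffler \<alpha> (- \<alpha> * ((u - x) powr \<alpha> / (1 - \<alpha>)))
        = (1 - \<alpha>) / B \<alpha> * ((\<psi>' x + l * RL_int_left \<alpha> a \<psi>' x) * mittag_leffler \<alpha> (- l * (u - x) powr \<alpha>))"
      using g \<psi>'(3)
    proof eventually_elim
      case (elim x)
      show ?case
      proof
        assume x: "x \<in> {a<..<u}"
        then have "g x = (1 - \<alpha>) / B \<alpha> * \<psi>' x + \<alpha> / B \<alpha> * RL_int_left \<alpha> a \<psi>' x"
          using elim u RL_int_left_cong_AE[OF \<psi>'(3), of x \<alpha>] by (simp add: AB_int_left_def)
        also have "\<dots> = (1 - \<alpha>) / B \<alpha> * (\<psi>' x + l * RL_int_left \<alpha> a \<psi>' x)"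
          using \<alpha> B unfolding l_def by (simp add: field_simps)
        finally show "g x * mittag_leffler \<alpha> (- \<alpha> * ((u - x) powr \<alpha> / (1 - \<alpha>)))
          = (1 - \<alpha>) / B \<alpha> * ((\<psi>' x + l * RL_int_left \<alpha> a \<psi>' x) * mittag_leffler \<alpha> (- l * (u - x) powr \<alpha>))"
          by (simp add: l_def)
      qed
    qed
    have "H u = (1 - \<alpha>) / B \<alpha> * (LINT x:{a<..<u}|lebesgue.
        (\<psi>' x + l * RL_int_left \<alpha> a \<psi>' x) * mittag_leffler \<alpha> (- l * (u - x) powr \<alpha>))"
      unfolding H_def set_integral_lebesgue_cong_AE[OF ae] by (rule set_integral_mult_right)
    also have "\<dots> = (1 - \<alpha>) / B \<alpha> * (LINT x:{a<..<u}|lborel. \<psi>' x)"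
      using u mittag_leffler_convolution_left[OF \<psi>'(1) int \<alpha> l] by simp
    finally show ?thesis
      unfolding set_integral_Ioo_eq_integral[OF int] .
  qed
  have deriv: "ABR_deriv_left B \<alpha> a g t = \<psi>' t" if t: "t \<in> {a<..<b}" "t \<notin> N" for t
  proof -
    have "((\<lambda>u. (1 - \<alpha>) / B \<alpha> * integral {a..u} \<psi>') has_real_derivative (1 - \<alpha>) / B \<alpha> * \<psi>' t) (at t)"
      using t by (intro DERIV_cmult N(2)) auto
    then have "(H has_real_derivative (1 - \<alpha>) / B \<alpha> * \<psi>' t) (at t)"
      by (rule has_field_derivative_transform_within_open[of _ _ _ "{a<..<b}"]) (use t H in auto)
    then show ?thesis
      using \<alpha> B unfolding ABR_deriv_left_def H_def by (simp add: DERIV_imp_deriv)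
  qed
  have "AE t in lebesgue. t \<notin> N"
    using N(1) by (simp add: negligible_iff_null_sets AE_not_in)
  with \<psi>'(3) show ?thesis
    by eventually_elim (use deriv in auto)
qed

lemma ABR_deriv_right_AB_int_right:
  assumes \<alpha>: "0 < \<alpha>" "\<alpha> < 1" and B: "B \<alpha> > 0" and p: "p \<ge> 1"
    and \<phi>: "\<phi> \<in> Lp_space p a b"
    and f: "AE x in lebesgue. x \<in> {a<..<b} \<longrightarrow> f x = AB_int_right B \<alpha> b \<phi> x"
  shows "AE t in lebesgue. t \<in> {a<..<b} \<longrightarrow> ABR_deriv_right B \<alpha> b f t = \<phi> t"
proof -
  obtain \<phi>' where \<phi>': "\<phi>' \<in> borel_measurable borel" "\<And>x. x \<notin> {a<..<b} \<Longrightarrow> \<phi>' x = 0"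
    "AE x in lebesgue. x \<in> {a<..<b} \<longrightarrow> \<phi> x = \<phi>' x"
    "(\<integral>\<^sup>+x. ennreal (\<bar>\<phi>' x\<bar> powr p) \<partial>lborel) < \<infinity>"
    using Lp_space_borel_representative[OF \<phi>] by blast
  have int: "integrable lborel \<phi>'"
    using integrable_of_powr_finite[OF \<phi>'(1,2,4) p] .
  obtain N where N: "negligible N"
    "\<And>a t. \<lbrakk>t \<notin> N; a < t\<rbrakk> \<Longrightarrow> ((\<lambda>u. integral {a..u} \<phi>') has_real_derivative \<phi>' t) (at t)"
    using Lebesgue_differentiation[OF int] by blast
  define l where "l = \<alpha> / (1 - \<alpha>)"
  have l: "l \<noteq> 0" using \<alpha> unfolding l_def by simp
  define H where "H = (\<lambda>u. LINT x:{u<..<b}|lebesgue.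
      f x * mittag_leffler \<alpha> (- \<alpha> * ((x - u) powr \<alpha> / (1 - \<alpha>))))"
  \<comment> \<open>The integral over the right part is rewritten as a constant minus the primitive,
    since \<open>N\<close> concerns a variable upper limit. The resulting minus sign cancels the one
    in \<open>ABR_deriv_right\<close>.\<close>
  have H: "H u = (1 - \<alpha>) / B \<alpha> * (integral {a..b} \<phi>' - integral {a..u} \<phi>')" if u: "u \<in> {a<..<b}" for u
  proof -
    have ae: "AE x in lebesgue. x \<in> {u<..<b} \<longrightarrow>
        f x * mittag_leffler \<alpha> (- \<alpha> * ((x - u) powr \<alpha> / (1 - \<alpha>)))
        = (1 - \<alpha>) / B \<alpha> * ((\<phi>' x + l * RL_int_right \<alpha> b \<phi>' x) * mittag_leffler \<alpha> (- l * (x - u) powr \<alpha>))"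
      using f \<phi>'(3)
    proof eventually_elim
      case (elim x)
      show ?case
      proof
        assume x: "x \<in> {u<..<b}"
        then have "f x = (1 - \<alpha>) / B \<alpha> * \<phi>' x + \<alpha> / B \<alpha> * RL_int_right \<alpha> b \<phi>' x"
          using elim u RL_int_right_cong_AE[OF \<phi>'(3), of x \<alpha>] by (simp add: AB_int_right_def)
        also have "\<dots> = (1 - \<alpha>) / B \<alpha> * (\<phi>' x + l * RL_int_right \<alpha> b \<phi>' x)"
          using \<alpha> B unfolding l_def by (simp add: field_simps)
        finally show "f x * mittag_leffler \<alpha> (- \<alpha> * ((x - u) powr \<alpha> / (1 - \<alpha>)))
          = (1 - \<alpha>) / B \<alpha> * ((\<phi>' x + l * RL_int_right \<alpha> b \<phi>' x) * mittag_leffler \<alpha> (- l * (x - u) powr \<alpha>))"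
          by (simp add: l_def)
      qed
    qed
    have "H u = (1 - \<alpha>) / B \<alpha> * (LINT x:{u<..<b}|lebesgue.
        (\<phi>' x + l * RL_int_right \<alpha> b \<phi>' x) * mittag_leffler \<alpha> (- l * (x - u) powr \<alpha>))"
      unfolding H_def set_integral_lebesgue_cong_AE[OF ae] by (rule set_integral_mult_right)
    also have "\<dots> = (1 - \<alpha>) / B \<alpha> * (LINT x:{u<..<b}|lborel. \<phi>' x)"
      using u mittag_leffler_convolution_right[OF \<phi>'(1) int \<alpha> l] by simp
    also have "(LINT x:{u<..<b}|lborel. \<phi>' x) = integral {a..b} \<phi>' - integral {a..u} \<phi>'"
    proof -
      have "\<phi>' integrable_on {a..b}"
        using integrable_on_lborel[OF int] by (rule integrable_on_subinterval) auto
      then have "integral {a..u} \<phi>' + integral {u..b} \<phi>' = integral {a..b} \<phi>'"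
        using u by (intro Henstock_Kurzweil_Integration.integral_combine) auto
      then show ?thesis
        unfolding set_integral_Ioo_eq_integral[OF int] by simp
    qed
    finally show ?thesis .
  qed
  have deriv: "ABR_deriv_right B \<alpha> b f t = \<phi>' t" if t: "t \<in> {a<..<b}" "t \<notin> N" for t
  proof -
    have "((\<lambda>u. (1 - \<alpha>) / B \<alpha> * (integral {a..b} \<phi>' - integral {a..u} \<phi>')) has_real_derivative
        (1 - \<alpha>) / B \<alpha> * (0 - \<phi>' t)) (at t)"
      using t by (intro DERIV_cmult DERIV_diff DERIV_const N(2)) auto
    then have "(H has_real_derivative (1 - \<alpha>) / B \<alpha> * (0 - \<phi>' t)) (at t)"
      by (rule has_field_derivative_transform_within_open[of _ _ _ "{a<..<b}"]) (use t H in auto)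
    then show ?thesis
      using \<alpha> B unfolding ABR_deriv_right_def H_def by (simp add: DERIV_imp_deriv)
  qed
  have "AE t in lebesgue. t \<notin> N"
    using N(1) by (simp add: negligible_iff_null_sets AE_not_in)
  with \<phi>'(3) show ?thesis
    by eventually_elim (use deriv in auto)
qed

section \<open>Integration by parts for the AB integrals\<close>

text \<open>Meant for \<open>u\<close> the product \<psi>\<phi>, the one term whose integrability is
  in doubt, and \<open>v\<close> a term with a fractional integral. As \<open>v\<close> is
  integrable and \<open>c\<close> is nonzero, \<open>u\<close> can be recovered from the
  combination.\<close>

lemma
  fixes u v :: "'a \<Rightarrow> real"
  assumes v: "set_integrable M A v" and c: "c \<noteq> 0"
  shows set_integrable_lincomb_iff: "set_integrable M A (\<lambda>x. c * u x + d * v x) \<longleftrightarrow> set_integrable M A u"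
    and set_integral_lincomb: "set_integrable M A u \<Longrightarrow>
      (LINT x:A|M. c * u x + d * v x) = c * (LINT x:A|M. u x) + d * (LINT x:A|M. v x)"
proof -
  have dv: "set_integrable M A (\<lambda>x. d * v x)"
    using v by simp
  show "set_integrable M A (\<lambda>x. c * u x + d * v x) \<longleftrightarrow> set_integrable M A u"
  proof
    assume "set_integrable M A (\<lambda>x. c * u x + d * v x)"
    from set_integral_diff(1)[OF this dv] show "set_integrable M A u"
      using c by simp
  qed (use dv in \<open>simp add: set_integral_add\<close>)
  show "(LINT x:A|M. c * u x + d * v x) = c * (LINT x:A|M. u x) + d * (LINT x:A|M. v x)"
    if "set_integrable M A u"
    using that v by (simp add: set_integral_add)
qed

text \<open>Both AB integrands are the same multiple of \<psi>\<phi> plus an integrable remainder,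
  and the two remainders have equal integrals. So they are integrable under the same condition,
  which makes the last equality unconditional.\<close>

lemma
  fixes a b \<alpha> p q :: real
  assumes \<alpha>: "0 < \<alpha>" "\<alpha> < 1" and B: "B \<alpha> > 0"
    and pq: "p \<ge> 1" "q \<ge> 1" "1 / p + 1 / q \<le> 1 + \<alpha>"
      "1 / p + 1 / q = 1 + \<alpha> \<Longrightarrow> p \<noteq> 1 \<and> q \<noteq> 1"
    and \<phi>: "\<phi> \<in> Lp_space p a b" and \<psi>: "\<psi> \<in> Lp_space q a b"
  shows set_integrable_mult_AB_int_left_iff:
      "set_integrable lebesgue {a<..<b} (\<lambda>x. \<phi> x * AB_int_left B \<alpha> a \<psi> x)
        \<longleftrightarrow> set_integrable lebesgue {a<..<b} (\<lambda>x. \<psi> x * \<phi> x)" (is "?L \<longleftrightarrow> ?I")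
    and set_integrable_mult_AB_int_right_iff:
      "set_integrable lebesgue {a<..<b} (\<lambda>x. \<psi> x * AB_int_right B \<alpha> b \<phi> x)
        \<longleftrightarrow> set_integrable lebesgue {a<..<b} (\<lambda>x. \<psi> x * \<phi> x)" (is "?R \<longleftrightarrow> _")
    and integral_mult_AB_int_left:
      "set_integrable lebesgue {a<..<b} (\<lambda>x. \<psi> x * \<phi> x) \<Longrightarrow>
        (LINT x:{a<..<b}|lebesgue. \<phi> x * AB_int_left B \<alpha> a \<psi> x)
          = (1 - \<alpha>) / B \<alpha> * (LINT x:{a<..<b}|lebesgue. \<psi> x * \<phi> x)
            + \<alpha> / B \<alpha> * (LINT x:{a<..<b}|lebesgue. RL_int_right \<alpha> b \<phi> x * \<psi> x)"
    and AB_int_by_parts: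
      "(LINT x:{a<..<b}|lebesgue. \<phi> x * AB_int_left B \<alpha> a \<psi> x)
        = (LINT x:{a<..<b}|lebesgue. \<psi> x * AB_int_right B \<alpha> b \<phi> x)"
proof -
  note RL = set_integrable_mult_RL_int_left_Lp[OF \<alpha> pq \<phi> \<psi>]
    set_integrable_RL_int_right_mult_Lp[OF \<alpha> pq \<phi> \<psi>] RL_int_by_parts_Lp[OF \<alpha> pq \<phi> \<psi>]
  have c: "(1 - \<alpha>) / B \<alpha> \<noteq> 0" using \<alpha> B by simp
  have l: "(\<lambda>x. \<phi> x * AB_int_left B \<alpha> a \<psi> x)
      = (\<lambda>x. (1 - \<alpha>) / B \<alpha> * (\<psi> x * \<phi> x) + \<alpha> / B \<alpha> * (\<phi> x * RL_int_left \<alpha> a \<psi> x))"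
    by (simp add: AB_int_left_def fun_eq_iff algebra_simps)
  have r: "(\<lambda>x. \<psi> x * AB_int_right B \<alpha> b \<phi> x)
      = (\<lambda>x. (1 - \<alpha>) / B \<alpha> * (\<psi> x * \<phi> x) + \<alpha> / B \<alpha> * (RL_int_right \<alpha> b \<phi> x * \<psi> x))"
    by (simp add: AB_int_right_def fun_eq_iff algebra_simps)
  show L: "?L \<longleftrightarrow> ?I"
    unfolding l by (rule set_integrable_lincomb_iff[OF RL(1) c])
  show R: "?R \<longleftrightarrow> ?I"
    unfolding r by (rule set_integrable_lincomb_iff[OF RL(2) c])
  show left: "(LINT x:{a<..<b}|lebesgue. \<phi> x * AB_int_left B \<alpha> a \<psi> x)
          = (1 - \<alpha>) / B \<alpha> * (LINT x:{a<..<b}|lebesgue. \<psi> x * \<phi> x)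
            + \<alpha> / B \<alpha> * (LINT x:{a<..<b}|lebesgue. RL_int_right \<alpha> b \<phi> x * \<psi> x)" if ?I
    unfolding l using set_integral_lincomb[OF RL(1) c that, of "\<alpha> / B \<alpha>"] RL(3) by simp
  show "(LINT x:{a<..<b}|lebesgue. \<phi> x * AB_int_left B \<alpha> a \<psi> x)
        = (LINT x:{a<..<b}|lebesgue. \<psi> x * AB_int_right B \<alpha> b \<phi> x)"
  proof (cases ?I)
    case True
    then show ?thesis
      unfolding left[OF True] r using set_integral_lincomb[OF RL(2) c True, of "\<alpha> / B \<alpha>"] by simp
  next
    case False
    \<comment> \<open>Neither side is integrable, so both integrals take the default value 0.\<close>
    then have "\<not> ?L" "\<not> ?R" using L R by auto
    then show ?thesis
      unfolding set_integrable_def set_lebesgue_integral_def by (simp add: not_integrable_integral_eq)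
  qed
qed

theorem theorem2p2:
  fixes a b \<alpha> p q :: real and B :: "real \<Rightarrow> real"
  assumes "a < b" and "0 < \<alpha>" and "\<alpha> < 1" and "B \<alpha> > 0"
    and "p \<ge> 1" and "q \<ge> 1"
    and "1 / p + 1 / q \<le> 1 + \<alpha>"
    and "1 / p + 1 / q = 1 + \<alpha> \<Longrightarrow> p \<noteq> 1 \<and> q \<noteq> 1"
  shows
    "(\<forall>\<phi>\<in>Lp_space p a b. \<forall>\<psi>\<in>Lp_space q a b.
        (1 / p + 1 / q \<le> 1 \<longrightarrow> set_integrable lebesgue {a<..<b} (\<lambda>x. \<psi> x * \<phi> x)) \<and>
        set_integrable lebesgue {a<..<b} (\<lambda>x. RL_int_right \<alpha> b \<phi> x * \<psi> x) \<and>
        (set_integrable lebesgue {a<..<b} (\<lambda>x. \<phi> x * AB_int_left B \<alpha> a \<psi> x) \<longleftrightarrow>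
           set_integrable lebesgue {a<..<b} (\<lambda>x. \<psi> x * \<phi> x)) \<and>
        (set_integrable lebesgue {a<..<b} (\<lambda>x. \<psi> x * AB_int_right B \<alpha> b \<phi> x) \<longleftrightarrow>
           set_integrable lebesgue {a<..<b} (\<lambda>x. \<psi> x * \<phi> x)) \<and>
        (set_integrable lebesgue {a<..<b} (\<lambda>x. \<psi> x * \<phi> x) \<longrightarrow>
           (LINT x:{a<..<b}|lebesgue. \<phi> x * AB_int_left B \<alpha> a \<psi> x) =
             (1 - \<alpha>) / B \<alpha> * (LINT x:{a<..<b}|lebesgue. \<psi> x * \<phi> x)
             + \<alpha> / B \<alpha> * (LINT x:{a<..<b}|lebesgue. RL_int_right \<alpha> b \<phi> x * \<psi> x)) \<and>
        (LINT x:{a<..<b}|lebesgue. \<phi> x * AB_int_left B \<alpha> a \<psi> x) =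
          (LINT x:{a<..<b}|lebesgue. \<psi> x * AB_int_right B \<alpha> b \<phi> x)) \<and>
     (\<forall>\<phi>\<in>Lp_space p a b. \<forall>\<psi>\<in>Lp_space q a b.
        set_integrable lebesgue {a<..<b} (\<lambda>x. RL_int_left \<alpha> a \<phi> x * \<psi> x) \<and>
        (set_integrable lebesgue {a<..<b} (\<lambda>x. \<phi> x * AB_int_right B \<alpha> b \<psi> x) \<longleftrightarrow>
           set_integrable lebesgue {a<..<b} (\<lambda>x. \<psi> x * \<phi> x)) \<and>
        (set_integrable lebesgue {a<..<b} (\<lambda>x. \<psi> x * AB_int_left B \<alpha> a \<phi> x) \<longleftrightarrow>
           set_integrable lebesgue {a<..<b} (\<lambda>x. \<psi> x * \<phi> x)) \<and>
        (set_integrable lebesgue {a<..<b} (\<lambda>x. \<psi> x * \<phi> x) \<longrightarrow>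
           (LINT x:{a<..<b}|lebesgue. \<phi> x * AB_int_right B \<alpha> b \<psi> x) =
             (1 - \<alpha>) / B \<alpha> * (LINT x:{a<..<b}|lebesgue. \<psi> x * \<phi> x)
             + \<alpha> / B \<alpha> * (LINT x:{a<..<b}|lebesgue. RL_int_left \<alpha> a \<phi> x * \<psi> x)) \<and>
        (LINT x:{a<..<b}|lebesgue. \<phi> x * AB_int_right B \<alpha> b \<psi> x) =
          (LINT x:{a<..<b}|lebesgue. \<psi> x * AB_int_left B \<alpha> a \<phi> x)) \<and>
     (\<forall>f\<in>AB_int_right_Lp B \<alpha> p a b. \<forall>g\<in>AB_int_left_Lp B \<alpha> q a b.
        (1 / p + 1 / q \<le> 1 \<longrightarrow>
           set_integrable lebesgue {a<..<b} (\<lambda>x. f x * ABR_deriv_left B \<alpha> a g x)) \<and>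
        (set_integrable lebesgue {a<..<b} (\<lambda>x. f x * ABR_deriv_left B \<alpha> a g x) \<longleftrightarrow>
           set_integrable lebesgue {a<..<b} (\<lambda>x. ABR_deriv_right B \<alpha> b f x * g x)) \<and>
        (LINT x:{a<..<b}|lebesgue. f x * ABR_deriv_left B \<alpha> a g x) =
          (LINT x:{a<..<b}|lebesgue. ABR_deriv_right B \<alpha> b f x * g x))"
proof (intro conjI ballI)
  note pq = assms(5-8)
  have qp: "1 / q + 1 / p \<le> 1 + \<alpha>" "1 / q + 1 / p = 1 + \<alpha> \<Longrightarrow> q \<noteq> 1 \<and> p \<noteq> 1"
    using pq by (auto simp: add.commute)
  {
    fix \<phi> \<psi> assume \<phi>: "\<phi> \<in> Lp_space p a b" and \<psi>: "\<psi> \<in> Lp_space q a b"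
    note AB = set_integrable_mult_AB_int_left_iff[where B = B and \<alpha> = \<alpha>, OF assms(2-4) pq \<phi> \<psi>]
      set_integrable_mult_AB_int_right_iff[where B = B and \<alpha> = \<alpha>, OF assms(2-4) pq \<phi> \<psi>]
      integral_mult_AB_int_left[where B = B and \<alpha> = \<alpha>, OF assms(2-4) pq \<phi> \<psi>]
      AB_int_by_parts[where B = B and \<alpha> = \<alpha>, OF assms(2-4) pq \<phi> \<psi>]
    show "1 / p + 1 / q \<le> 1 \<longrightarrow> set_integrable lebesgue {a<..<b} (\<lambda>x. \<psi> x * \<phi> x)"
      using set_integrable_mult_Lp[OF pq(1,2) _ \<phi> \<psi>] by blast
    show "set_integrable lebesgue {a<..<b} (\<lambda>x. RL_int_right \<alpha> b \<phi> x * \<psi> x)"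
      by (rule set_integrable_RL_int_right_mult_Lp[OF assms(2,3) pq \<phi> \<psi>])
    show "set_integrable lebesgue {a<..<b} (\<lambda>x. \<phi> x * AB_int_left B \<alpha> a \<psi> x) \<longleftrightarrow>
           set_integrable lebesgue {a<..<b} (\<lambda>x. \<psi> x * \<phi> x)"
      by (rule AB(1))
    show "set_integrable lebesgue {a<..<b} (\<lambda>x. \<psi> x * AB_int_right B \<alpha> b \<phi> x) \<longleftrightarrow>
           set_integrable lebesgue {a<..<b} (\<lambda>x. \<psi> x * \<phi> x)"
      by (rule AB(2))
    show "set_integrable lebesgue {a<..<b} (\<lambda>x. \<psi> x * \<phi> x) \<longrightarrow>
           (LINT x:{a<..<b}|lebesgue. \<phi> x * AB_int_left B \<alpha> a \<psi> x) =
             (1 - \<alpha>) / B \<alpha> * (LINT x:{a<..<b}|lebesgue. \<psi> x * \<phi> x)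
             + \<alpha> / B \<alpha> * (LINT x:{a<..<b}|lebesgue. RL_int_right \<alpha> b \<phi> x * \<psi> x)"
      using AB(3) by blast
    show "(LINT x:{a<..<b}|lebesgue. \<phi> x * AB_int_left B \<alpha> a \<psi> x) =
          (LINT x:{a<..<b}|lebesgue. \<psi> x * AB_int_right B \<alpha> b \<phi> x)"
      by (rule AB(4))
  next
    fix \<phi> \<psi> assume \<phi>: "\<phi> \<in> Lp_space p a b" and \<psi>: "\<psi> \<in> Lp_space q a b"
    have comm: "(\<lambda>x. \<phi> x * \<psi> x) = (\<lambda>x. \<psi> x * \<phi> x)" by (simp add: mult.commute)
    have commRL: "(\<lambda>x. \<psi> x * RL_int_left \<alpha> a \<phi> x) = (\<lambda>x. RL_int_left \<alpha> a \<phi> x * \<psi> x)"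
      by (simp add: mult.commute)
    \<comment> \<open>The second half of part (1) is the first half with \<open>(p, \<phi>)\<close>
      and \<open>(q, \<psi>)\<close> interchanged.\<close>
    note AB = set_integrable_mult_AB_int_left_iff[where B = B and \<alpha> = \<alpha>, OF assms(2-4) pq(2,1) qp \<psi> \<phi>, unfolded comm]
      set_integrable_mult_AB_int_right_iff[where B = B and \<alpha> = \<alpha>, OF assms(2-4) pq(2,1) qp \<psi> \<phi>, unfolded comm]
      integral_mult_AB_int_left[where B = B and \<alpha> = \<alpha>, OF assms(2-4) pq(2,1) qp \<psi> \<phi>, unfolded comm]
      AB_int_by_parts[where B = B and \<alpha> = \<alpha>, OF assms(2-4) pq(2,1) qp \<psi> \<phi>]
    show "set_integrable lebesgue {a<..<b} (\<lambda>x. RL_int_left \<alpha> a \<phi> x * \<psi> x)"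
      using set_integrable_mult_RL_int_left_Lp[OF assms(2,3) pq(2,1) qp \<psi> \<phi>] unfolding commRL .
    show "set_integrable lebesgue {a<..<b} (\<lambda>x. \<phi> x * AB_int_right B \<alpha> b \<psi> x) \<longleftrightarrow>
           set_integrable lebesgue {a<..<b} (\<lambda>x. \<psi> x * \<phi> x)"
      by (rule AB(2))
    show "set_integrable lebesgue {a<..<b} (\<lambda>x. \<psi> x * AB_int_left B \<alpha> a \<phi> x) \<longleftrightarrow>
           set_integrable lebesgue {a<..<b} (\<lambda>x. \<psi> x * \<phi> x)"
      by (rule AB(1))
    \<comment> \<open>The interchanged formula has the right integral of \<psi> against \<phi>; one
      more integration by parts turns it into the left integral of \<phi> against \<psi>.\<close>
    show "set_integrable lebesgue {a<..<b} (\<lambda>x. \<psi> x * \<phi> x) \<longrightarrow>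
           (LINT x:{a<..<b}|lebesgue. \<phi> x * AB_int_right B \<alpha> b \<psi> x) =
             (1 - \<alpha>) / B \<alpha> * (LINT x:{a<..<b}|lebesgue. \<psi> x * \<phi> x)
             + \<alpha> / B \<alpha> * (LINT x:{a<..<b}|lebesgue. RL_int_left \<alpha> a \<phi> x * \<psi> x)"
      using AB(3,4) RL_int_by_parts_Lp[OF assms(2,3) pq(2,1) qp \<psi> \<phi>] unfolding commRL by simp
    show "(LINT x:{a<..<b}|lebesgue. \<phi> x * AB_int_right B \<alpha> b \<psi> x) =
          (LINT x:{a<..<b}|lebesgue. \<psi> x * AB_int_left B \<alpha> a \<phi> x)"
      by (rule AB(4)[symmetric])
  next
    fix f g assume "f \<in> AB_int_right_Lp B \<alpha> p a b" and "g \<in> AB_int_left_Lp B \<alpha> q a b"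
    then obtain \<phi> \<psi> where \<phi>: "\<phi> \<in> Lp_space p a b" and \<psi>: "\<psi> \<in> Lp_space q a b"
      and f: "AE x in lebesgue. x \<in> {a<..<b} \<longrightarrow> f x = AB_int_right B \<alpha> b \<phi> x"
      and g: "AE x in lebesgue. x \<in> {a<..<b} \<longrightarrow> g x = AB_int_left B \<alpha> a \<psi> x"
      unfolding AB_int_right_Lp_def AB_int_left_Lp_def by blast
    note AB = set_integrable_mult_AB_int_left_iff[where B = B and \<alpha> = \<alpha>, OF assms(2-4) pq \<phi> \<psi>]
      set_integrable_mult_AB_int_right_iff[where B = B and \<alpha> = \<alpha>, OF assms(2-4) pq \<phi> \<psi>]
      AB_int_by_parts[where B = B and \<alpha> = \<alpha>, OF assms(2-4) pq \<phi> \<psi>]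
    \<comment> \<open>Inverting the AB integrals produces the two outer integrands of part (1), in
      reversed order.\<close>
    have l: "AE x in lebesgue. x \<in> {a<..<b} \<longrightarrow>
        f x * ABR_deriv_left B \<alpha> a g x = \<psi> x * AB_int_right B \<alpha> b \<phi> x"
      using f ABR_deriv_left_AB_int_left[where B = B and \<alpha> = \<alpha>, OF assms(2-4) pq(2) \<psi> g] by eventually_elim auto
    have r: "AE x in lebesgue. x \<in> {a<..<b} \<longrightarrow>
        ABR_deriv_right B \<alpha> b f x * g x = \<phi> x * AB_int_left B \<alpha> a \<psi> x"
      using g ABR_deriv_right_AB_int_right[where B = B and \<alpha> = \<alpha>, OF assms(2-4) pq(1) \<phi> f] by eventually_elim auto
    note cong = set_integrable_lebesgue_cong_AE[OF l] set_integrable_lebesgue_cong_AE[OF r]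
      set_integral_lebesgue_cong_AE[OF l] set_integral_lebesgue_cong_AE[OF r]
    show "1 / p + 1 / q \<le> 1 \<longrightarrow>
           set_integrable lebesgue {a<..<b} (\<lambda>x. f x * ABR_deriv_left B \<alpha> a g x)"
      using set_integrable_mult_Lp[OF pq(1,2) _ \<phi> \<psi>] cong(1) AB(2) by blast
    show "set_integrable lebesgue {a<..<b} (\<lambda>x. f x * ABR_deriv_left B \<alpha> a g x) \<longleftrightarrow>
           set_integrable lebesgue {a<..<b} (\<lambda>x. ABR_deriv_right B \<alpha> b f x * g x)"
      using cong(1,2) AB(1,2) by blast
    show "(LINT x:{a<..<b}|lebesgue. f x * ABR_deriv_left B \<alpha> a g x) =
          (LINT x:{a<..<b}|lebesgue. ABR_deriv_right B \<alpha> b f x * g x)"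
      using cong(3,4) AB(3) by simp
  }
qed

end
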